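(* Let $\{X_j\}$ be a fourth-order stationary sequence with $\mu=EX_j$, autocovariances $\gamma_j=\mathrm{Cov}(X_0,X_j)$ and fourth-order cumulants $\kappa(h,r,s)$, such that for some $\frac12<H<1$: (a) $n^{-H}\sum_{1\le j\le nt}(X_j-\mu)\xrightarrow{d}c_HW_H(t)$ in $D[0,1]$ for some $c_H>0$; (b) $\gamma_j\sim c_0j^{2H-2}$ for some $c_0>0$; (c) $\sup_h\sum_{-n\le r,s\le n}|\kappa(h,r,s)|=O(n^{2H-1})$. If $q(n)\to\infty$ and $q(n)/n\to0$, then $$\Big(\frac{q(n)}n\Big)^{H-1/2}T_n\xrightarrow{d}\sup_{0\le t\le1}|W_H(t)-tW_H(1)|.$$
   Context: $W_H$ is fractional Brownian motion: a mean-zero Gaussian process with $E[W_H(t)W_H(s)]=(t^{2H}+s^{2H}-|t-s|^{2H})/2$. Fourth-order stationary means finite fourth moments and shift-invariant joint moments of order at most four; $\kappa(h,r,s)=E[Z_kZ_{k+h}Z_{k+r}Z_{k+s}]-(\gamma_h\gamma_{r-s}+\gamma_r\gamma_{h-s}+\gamma_s\gamma_{h-r})$ with $Z_k=X_k-\mu$. $a_j\sim b_j$ means $a_j/b_j\to1$. $q(n)$ is a sequence of positive integers, $\omega_j(q)=1-j/(q+1)$, $\bar X_n=\frac1n\sum_{i\le n}X_i$, $\hat\gamma_j=\frac1n\sum_{1\le i\le n-j}(X_i-\bar X_n)(X_{i+j}-\bar X_n)$, $s_n^2=\hat\gamma_0+2\sum_{1\le j\le q(n)}\omega_j(q(n))\hat\gamma_j$,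 $T_n=\frac1{n^{1/2}s_n}\max_{1\le k\le n}|\sum_{i\le k}X_i-\frac kn\sum_{i\le n}X_i|$. *)

theory Defs
  imports "HOL-Probability.Probability"
begin

definition cadlag01 :: "(real \<Rightarrow> real) set" where
  "cadlag01 = {x. (\<forall>t\<in>{0..<1}. continuous (at_right t) x) \<and>
                  (\<forall>t\<in>{0<..1}. \<exists>l. (x \<longlongrightarrow> l) (at_left t))}"

definition time_changes01 :: "(real \<Rightarrow> real) set" where
  "time_changes01 = {g. strict_mono_on {0..1} g \<and> continuous_on {0..1} g \<and> g 0 = 0 \<and> g 1 = 1}"

definition skorokhod_dist :: "(real \<Rightarrow> real) \<Rightarrow> (real \<Rightarrow> real) \<Rightarrow> real" where
  "skorokhod_dist x y = (INF g\<in>time_changes01.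
      max (SUP t\<in>{0..1}. \<bar>g t - t\<bar>) (SUP t\<in>{0..1}. \<bar>x t - y (g t)\<bar>))"

definition skorokhod_bdd_cont :: "((real \<Rightarrow> real) \<Rightarrow> real) \<Rightarrow> bool" where
  "skorokhod_bdd_cont f \<longleftrightarrow> bounded (f ` cadlag01) \<and>
     (\<forall>x\<in>cadlag01. \<forall>e>0. \<exists>d>0. \<forall>y\<in>cadlag01. skorokhod_dist x y < d \<longrightarrow> \<bar>f y - f x\<bar> < e)"

definition conv_distr_D :: "'a measure \<Rightarrow> (nat \<Rightarrow> 'a \<Rightarrow> real \<Rightarrow> real) \<Rightarrow> 'b measure \<Rightarrow> ('b \<Rightarrow> real \<Rightarrow> real) \<Rightarrow> bool" where
  "conv_distr_D M Y N Z \<longleftrightarrow>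
     (\<forall>f. skorokhod_bdd_cont f \<and> (\<forall>n. (\<lambda>\<omega>. f (Y n \<omega>)) \<in> borel_measurable M)
          \<and> (\<lambda>\<omega>. f (Z \<omega>)) \<in> borel_measurable N \<longrightarrow>
        (\<lambda>n. \<integral>\<omega>. f (Y n \<omega>) \<partial>M) \<longlonglongrightarrow> (\<integral>\<omega>. f (Z \<omega>) \<partial>N))"

definition gaussian_rv :: "'a measure \<Rightarrow> ('a \<Rightarrow> real) \<Rightarrow> real \<Rightarrow> real \<Rightarrow> bool" where
  "gaussian_rv M Y m v \<longleftrightarrow>
     (v = 0 \<and> Y \<in> borel_measurable M \<and> (AE \<omega> in M. Y \<omega> = m)) \<or>
     (v > 0 \<and> distributed M lborel Y (normal_density m (sqrt v)))"

definition fbm_cov :: "real \<Rightarrow> real \<Rightarrow> real \<Rightarrow> real" where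
  "fbm_cov H t s = (t powr (2*H) + s powr (2*H) - \<bar>t - s\<bar> powr (2*H)) / 2"

definition is_fbm :: "real \<Rightarrow> 'b measure \<Rightarrow> ('b \<Rightarrow> real \<Rightarrow> real) \<Rightarrow> bool" where
  "is_fbm H N W \<longleftrightarrow> prob_space N \<and>
     (\<forall>\<omega>\<in>space N. continuous_on {0..1} (W \<omega>)) \<and>
     (\<forall>(F::real set) (a::real \<Rightarrow> real). finite F \<and> F \<subseteq> {0..1} \<longrightarrow>
        gaussian_rv N (\<lambda>\<omega>. \<Sum>t\<in>F. a t * W \<omega> t) 0 (\<Sum>s\<in>F. \<Sum>t\<in>F. a s * a t * fbm_cov H s t))"

definition fourth_order_stationary :: "'a measure \<Rightarrow> (int \<Rightarrow> 'a \<Rightarrow> real) \<Rightarrow> bool" where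
  "fourth_order_stationary M X \<longleftrightarrow>
     (\<forall>j. X j \<in> borel_measurable M \<and> integrable M (\<lambda>\<omega>. (X j \<omega>) ^ 4)) \<and>
     (\<forall>(idx::int list) k. length idx \<le> 4 \<longrightarrow>
        (\<integral>\<omega>. prod_list (map (\<lambda>i. X (i + k) \<omega>) idx) \<partial>M) =
        (\<integral>\<omega>. prod_list (map (\<lambda>i. X i \<omega>) idx) \<partial>M))"

definition seq_mean :: "'a measure \<Rightarrow> (int \<Rightarrow> 'a \<Rightarrow> real) \<Rightarrow> real" where
  "seq_mean M X = (\<integral>\<omega>. X 0 \<omega> \<partial>M)"

definition autocov :: "'a measure \<Rightarrow> (int \<Rightarrow> 'a \<Rightarrow> real) \<Rightarrow> int \<Rightarrow> real" where
  "autocov M X j = (\<integral>\<omega>. (X 0 \<omega> - seq_mean M X) * (X j \<omega> - seq_mean M X) \<partial>M)"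

definition cum4 :: "'a measure \<Rightarrow> (int \<Rightarrow> 'a \<Rightarrow> real) \<Rightarrow> int \<Rightarrow> int \<Rightarrow> int \<Rightarrow> real" where
  "cum4 M X h r s =
     (\<integral>\<omega>. (X 0 \<omega> - seq_mean M X) * (X h \<omega> - seq_mean M X) *
          (X r \<omega> - seq_mean M X) * (X s \<omega> - seq_mean M X) \<partial>M)
     - (autocov M X h * autocov M X (r - s) + autocov M X r * autocov M X (h - s)
        + autocov M X s * autocov M X (h - r))"

definition sample_mean :: "(int \<Rightarrow> 'a \<Rightarrow> real) \<Rightarrow> nat \<Rightarrow> 'a \<Rightarrow> real" where
  "sample_mean X n \<omega> = (\<Sum>i=1..n. X (int i) \<omega>) / real n"

definition sample_autocov :: "(int \<Rightarrow> 'a \<Rightarrow> real) \<Rightarrow> nat \<Rightarrow> nat \<Rightarrow> 'a \<Rightarrow> real" where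
  "sample_autocov X n j \<omega> = (\<Sum>i=1..n-j. (X (int i) \<omega> - sample_mean X n \<omega>) *
                                        (X (int (i + j)) \<omega> - sample_mean X n \<omega>)) / real n"

definition bartlett_weight :: "nat \<Rightarrow> nat \<Rightarrow> real" where
  "bartlett_weight q j = 1 - real j / real (q + 1)"

definition lrv_sq :: "(int \<Rightarrow> 'a \<Rightarrow> real) \<Rightarrow> (nat \<Rightarrow> nat) \<Rightarrow> nat \<Rightarrow> 'a \<Rightarrow> real" where
  "lrv_sq X q n \<omega> = sample_autocov X n 0 \<omega> +
      2 * (\<Sum>j=1..q n. bartlett_weight (q n) j * sample_autocov X n j \<omega>)"

definition kpss_T :: "(int \<Rightarrow> 'a \<Rightarrow> real) \<Rightarrow> (nat \<Rightarrow> nat) \<Rightarrow> nat \<Rightarrow> 'a \<Rightarrow> real" where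
  "kpss_T X q n \<omega> = Max ((\<lambda>k. \<bar>(\<Sum>i=1..k. X (int i) \<omega>) - real k / real n * (\<Sum>i=1..n. X (int i) \<omega>)\<bar>) ` {1..n})
      / (sqrt (real n) * sqrt (lrv_sq X q n \<omega>))"

definition partial_sum_process :: "real \<Rightarrow> real \<Rightarrow> (int \<Rightarrow> 'a \<Rightarrow> real) \<Rightarrow> nat \<Rightarrow> 'a \<Rightarrow> real \<Rightarrow> real" where
  "partial_sum_process H mu X n \<omega> t =
     real n powr (-H) * (\<Sum>j=1..nat \<lfloor>real n * t\<rfloor>. (X (int j) \<omega> - mu))"

end

theory Submission
  imports Defs
begin

text \<open>
  The statistic factors as the maximal deviation of the partial sums, normalised by n^H, times
  q^(H - 1/2) / s_n. The first factor is, up to |Y_n(1)| / n, the supremum of the bridge of the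
  partial sum process Y_n, a Skorokhod-continuous functional, so it converges in law to cH times the
  supremum of the fractional Brownian bridge. It remains to see that s_n^2 / q^(2H - 1) tends to
  cH^2 in probability.

  With p = q + 1, the Bartlett weights make s_n^2 / p^(2H - 1) equal to 1/n times the sum of the
  squares (B_m / p^H)^2 over the windows of length p, where B_m are window sums of the centred data.
  Replacing them by complete, uncentred block sums costs O((p/n)^(2 - 2H)) in mean square, and the
  variance of the resulting average is of the same order: its Gaussian part is controlled by the sum
  of |gamma_k| for |k| at most n, which is O(n^(2H - 1)), and the rest by the cumulant condition.
  The mean is E(Y_p(1)^2). Since the fourth moments of Y_p(1) are bounded, it converges to the second
  moment cH^2 of the limit law; the relation between cH and c0 is never needed.
\<close>

section \<open>Skorokhod-continuous functionals\<close>

text \<open>Every error has the same order because, with T = n p^(2H) as normaliser, p^2 n^(2H - 1)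
  equals (p/n)^(2 - 2H) T. For the variance, the covariance of two squared block sums is 2 R^2 plus
  a cumulant term, where R is the covariance of the two block sums. One factor R is bounded by a
  multiple of p^(2H) and only the other is summed over window positions, so sums of squared
  autocovariances, whose growth changes at H = 3/4, never occur. Cross terms between block sums and
  their corrections are split by Young's inequality with a parameter e. The resulting bound has the
  form K(e) (p/n)^(2 - 2H) + K' e, so n tends to infinity first and e to 0 afterwards. Convergence
  in law does not by itself carry second moments; the same bounds on covariance and cumulant sums
  are therefore used a second time, for fourth moments of a single block. The hypothesis of
  convergence in D[0,1] applies only to functionals whose compositions with the paths are
  measurable, so the measurability of the path supremum has to be proved as well.\<close>

lemma cadlag01_bounded:
  assumes x: "x \<in> cadlag01"
  shows "bounded (x ` {0..1})"
proof -
  \<comment> \<open>Bisection via \<open>Bolzano\<close>: boundedness passes to unions of adjacent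
    intervals, and one-sided limits bound \<open>x\<close> near each point. Small intervals around 0
    or 1 may leave the domain, hence the intersection with \<open>{0..1}\<close>.\<close>
  define P where "P a b \<longleftrightarrow> bounded (x ` ({a..b} \<inter> {0..1}))" for a b :: real
  have "P 0 1"
  proof (rule Bolzano)
    show "(0::real) \<le> 1" by simp
  next
    fix a b c assume "P a b" "P b c" "a \<le> b" "b \<le> c"
    moreover have "{a..c} \<inter> {0..1} = ({a..b} \<inter> {0..1}) \<union> ({b..c} \<inter> {0..1})"
      using \<open>a \<le> b\<close> \<open>b \<le> c\<close> by auto
    ultimately show "P a c" unfolding P_def by (simp add: image_Un)
  next
    fix t :: real assume t: "0 \<le> t" "t \<le> 1"
    have "\<exists>d>0. \<exists>B. \<forall>s. t < s \<and> s < t + d \<and> s \<le> 1 \<longrightarrow> \<bar>x s\<bar> \<le> B"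
    proof (cases "t < 1")
      case True
      then have "(x \<longlongrightarrow> x t) (at_right t)"
        using x t by (auto simp: cadlag01_def continuous_within)
      then have "\<forall>\<^sub>F s in at_right t. dist (x s) (x t) < 1"
        by (rule tendstoD) simp
      then obtain b where "b > t" "\<And>s. t < s \<Longrightarrow> s < b \<Longrightarrow> dist (x s) (x t) < 1"
        unfolding eventually_at_right_field by blast
      then have "\<forall>s. t < s \<and> s < t + (b - t) \<and> s \<le> 1 \<longrightarrow> \<bar>x s\<bar> \<le> \<bar>x t\<bar> + 1"
        by (fastforce simp: dist_real_def)
      then show ?thesis using \<open>b > t\<close> by (meson diff_gt_0_iff_gt)
    next
      case False
      then show ?thesis using t by (intro exI[of _ 1]) auto
    qed
    then obtain d1 B1 where 1: "d1 > 0" "\<And>s. t < s \<Longrightarrow> s < t + d1 \<Longrightarrow> s \<le> 1 \<Longrightarrow> \<bar>x s\<bar> \<le> B1"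
      by blast
    have "\<exists>d>0. \<exists>B. \<forall>s. t - d < s \<and> s < t \<and> 0 \<le> s \<longrightarrow> \<bar>x s\<bar> \<le> B"
    proof (cases "0 < t")
      case True
      then obtain l where "(x \<longlongrightarrow> l) (at_left t)"
        using x t unfolding cadlag01_def by fastforce
      then have "\<forall>\<^sub>F s in at_left t. dist (x s) l < 1"
        by (rule tendstoD) simp
      then obtain b where "b < t" "\<And>s. b < s \<Longrightarrow> s < t \<Longrightarrow> dist (x s) l < 1"
        unfolding eventually_at_left_field by blast
      then have "\<forall>s. t - (t - b) < s \<and> s < t \<and> 0 \<le> s \<longrightarrow> \<bar>x s\<bar> \<le> \<bar>l\<bar> + 1"
        by (fastforce simp: dist_real_def)
      then show ?thesis using \<open>b < t\<close> by (meson diff_gt_0_iff_gt)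
    next
      case False
      then show ?thesis using t by (intro exI[of _ 1]) auto
    qed
    then obtain d2 B2 where 2: "d2 > 0" "\<And>s. t - d2 < s \<Longrightarrow> s < t \<Longrightarrow> 0 \<le> s \<Longrightarrow> \<bar>x s\<bar> \<le> B2"
      by blast
    have "P a b" if "a \<le> t \<and> t \<le> b \<and> b - a < min d1 d2" for a b
      unfolding P_def bounded_iff
    proof (intro exI ballI)
      fix y assume "y \<in> x ` ({a..b} \<inter> {0..1})"
      then obtain s where s: "y = x s" "a \<le> s" "s \<le> b" "0 \<le> s" "s \<le> 1" by auto
      show "norm y \<le> \<bar>B1\<bar> + \<bar>B2\<bar> + \<bar>x t\<bar>"
      proof (cases s t rule: linorder_cases)
        case less then show ?thesis using 2(2)[of s] s that by auto
      next
        case equal then show ?thesis using s by auto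
      next
        case greater then show ?thesis using 1(2)[of s] s that by auto
      qed
    qed
    then show "\<exists>d>0. \<forall>a b. a \<le> t \<and> t \<le> b \<and> b - a < d \<longrightarrow> P a b"
      using 1(1) 2(1) by (intro exI[of _ "min d1 d2"]) auto
  qed
  then show ?thesis by (simp add: P_def)
qed

lemma time_changes01_image:
  assumes g: "g \<in> time_changes01"
  shows "g ` {0..1} = {0..1}"
proof
  show "g ` {0..1} \<subseteq> {0..1}"
  proof
    fix y assume "y \<in> g ` {0..1}"
    then obtain t where t: "y = g t" "t \<in> {0..1}" by auto
    have m: "mono_on {0..1} g"
      using g strict_mono_on_imp_mono_on by (auto simp: time_changes01_def)
    have "g 0 \<le> g t" "g t \<le> g 1"
      using t by (auto intro!: mono_onD[OF m])
    then show "y \<in> {0..1}" using g t by (auto simp: time_changes01_def)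
  qed
  show "{0..1} \<subseteq> g ` {0..1}"
  proof
    fix y :: real assume "y \<in> {0..1}"
    then have "\<exists>t\<ge>0. t \<le> 1 \<and> g t = y"
      using g by (intro IVT') (auto simp: time_changes01_def)
    then show "y \<in> g ` {0..1}" by auto
  qed
qed

text \<open>A real \<open>SUP\<close> dominates its terms only when the set is bounded above, so
  turning a small distance into pointwise bounds takes bounded paths and a time change that stays in
  the unit interval.\<close>

lemma skorokhod_dist_lessE:
  assumes x: "x \<in> cadlag01" and y: "y \<in> cadlag01" and d: "skorokhod_dist x y < d"
  obtains g where "g \<in> time_changes01"
    "\<And>t. t \<in> {0..1} \<Longrightarrow> \<bar>g t - t\<bar> < d" "\<And>t. t \<in> {0..1} \<Longrightarrow> \<bar>x t - y (g t)\<bar> < d"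
proof -
  let ?F = "\<lambda>g. max (SUP t\<in>{0..1}. \<bar>g t - t\<bar>) (SUP t\<in>{0..1}. \<bar>x t - y (g t)\<bar>)"
  have "(\<lambda>t. t) \<in> time_changes01"
    by (auto simp: time_changes01_def strict_mono_on_def)
  then have ne: "?F ` time_changes01 \<noteq> {}" by auto
  obtain Bx where Bx: "\<And>t. t \<in> {0..1} \<Longrightarrow> \<bar>x t\<bar> \<le> Bx"
    using cadlag01_bounded[OF x] unfolding bounded_iff by (metis image_eqI real_norm_def)
  obtain By where By: "\<And>t. t \<in> {0..1} \<Longrightarrow> \<bar>y t\<bar> \<le> By"
    using cadlag01_bounded[OF y] unfolding bounded_iff by (metis image_eqI real_norm_def)
  obtain z where "z \<in> ?F ` time_changes01" "z < d"
    using cInf_lessD[OF ne] d unfolding skorokhod_dist_def by blast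
  then obtain g where g: "g \<in> time_changes01" and gF: "?F g < d" by auto
  have gim: "\<And>t. t \<in> {0..1} \<Longrightarrow> g t \<in> {0..1}" using time_changes01_image[OF g] by auto
  have bdd1: "bdd_above ((\<lambda>t. \<bar>g t - t\<bar>) ` {0..1})"
  proof (rule bdd_aboveI2)
    fix t :: real assume "t \<in> {0..1}"
    then show "\<bar>g t - t\<bar> \<le> 1" using gim[of t] by auto
  qed
  have bdd2: "bdd_above ((\<lambda>t. \<bar>x t - y (g t)\<bar>) ` {0..1})"
  proof (rule bdd_aboveI2)
    fix t :: real assume "t \<in> {0..1}"
    then show "\<bar>x t - y (g t)\<bar> \<le> Bx + By" using Bx[of t] By[of "g t"] gim[of t] by linarith
  qed
  show ?thesis
  proof
    show "g \<in> time_changes01" by fact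
    fix t :: real assume t: "t \<in> {0..1}"
    show "\<bar>g t - t\<bar> < d"
      using cSUP_upper[OF t bdd1] gF by linarith
    show "\<bar>x t - y (g t)\<bar> < d"
      using cSUP_upper[OF t bdd2] gF by linarith
  qed
qed

definition bridge_sup :: "(real \<Rightarrow> real) \<Rightarrow> real" where
  "bridge_sup x = (SUP t\<in>{0..1}. \<bar>x t - t * x 1\<bar>)"

lemma bridge_bdd:
  fixes x :: "real \<Rightarrow> real"
  assumes "bounded (x ` {0..1})"
  shows "bdd_above ((\<lambda>t. \<bar>x t - t * x 1\<bar>) ` {0..1})"
proof -
  obtain B where B: "\<And>t. t \<in> {0..1} \<Longrightarrow> \<bar>x t\<bar> \<le> B"
    using assms unfolding bounded_iff by (metis image_eqI real_norm_def)
  show ?thesis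
  proof (rule bdd_aboveI2)
    fix t :: real assume t: "t \<in> {0..1}"
    have "\<bar>t * x 1\<bar> \<le> 1 * B" unfolding abs_mult using t B[of 1] by (intro mult_mono) auto
    then show "\<bar>x t - t * x 1\<bar> \<le> B + B" using B[of t] t by linarith
  qed
qed

lemma bridge_le_bridge_sup:
  assumes "bounded (x ` {0..1})" "t \<in> {0..1}"
  shows "\<bar>x t - t * x 1\<bar> \<le> bridge_sup x"
  unfolding bridge_sup_def by (rule cSUP_upper[OF assms(2) bridge_bdd[OF assms(1)]])

text \<open>Time \<open>t\<close> on \<open>x\<close> is matched with time \<open>g t\<close> on
  \<open>y\<close>, as the Skorokhod distance does not compare paths at equal times; surjectivity of
  \<open>g\<close> makes both suprema range over all times. The constant adds the path error, the
  endpoint error and the time shift multiplied by \<open>x 1\<close>. It depends on \<open>x\<close>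
  alone, which suits continuity at \<open>x\<close>.\<close>

lemma bridge_sup_diff_le:
  assumes x: "x \<in> cadlag01" and y: "y \<in> cadlag01" and d: "skorokhod_dist x y < d"
  shows "\<bar>bridge_sup y - bridge_sup x\<bar> \<le> d * (2 + \<bar>x 1\<bar>)"
proof -
  obtain g where g: "g \<in> time_changes01"
    and g1: "\<And>t. t \<in> {0..1} \<Longrightarrow> \<bar>g t - t\<bar> < d" and g2: "\<And>t. t \<in> {0..1} \<Longrightarrow> \<bar>x t - y (g t)\<bar> < d"
    using skorokhod_dist_lessE[OF assms] by blast
  have gim: "\<And>t. t \<in> {0..1} \<Longrightarrow> g t \<in> {0..1}" using time_changes01_image[OF g] by auto
  have one: "\<bar>x 1 - y 1\<bar> < d" using g2[of 1] g by (auto simp: time_changes01_def)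
  have diff: "\<bar>(x t - t * x 1) - (y (g t) - g t * y 1)\<bar> \<le> d * (2 + \<bar>x 1\<bar>)" if t: "t \<in> {0..1}" for t
  proof -
    have e: "(x t - t * x 1) - (y (g t) - g t * y 1)
        = (x t - y (g t)) + (g t - t) * x 1 - g t * (x 1 - y 1)" by (simp add: algebra_simps)
    have "\<bar>(g t - t) * x 1\<bar> \<le> d * \<bar>x 1\<bar>"
      unfolding abs_mult using g1[OF t] by (intro mult_mono) auto
    moreover have "\<bar>g t * (x 1 - y 1)\<bar> \<le> 1 * d"
      unfolding abs_mult using gim[OF t] one by (intro mult_mono) auto
    ultimately show ?thesis unfolding e using g2[OF t] by (simp add: algebra_simps)
  qed
  have "bridge_sup x \<le> bridge_sup y + d * (2 + \<bar>x 1\<bar>)"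
    unfolding bridge_sup_def[of x]
  proof (rule cSUP_least)
    fix t :: real assume t: "t \<in> {0..1}"
    show "\<bar>x t - t * x 1\<bar> \<le> bridge_sup y + d * (2 + \<bar>x 1\<bar>)"
      using diff[OF t] bridge_le_bridge_sup[OF cadlag01_bounded[OF y] gim[OF t]] by linarith
  qed auto
  moreover have "bridge_sup y \<le> bridge_sup x + d * (2 + \<bar>x 1\<bar>)"
    unfolding bridge_sup_def[of y]
  proof (rule cSUP_least)
    fix s :: real assume "s \<in> {0..1}"
    then obtain t where t: "t \<in> {0..1}" "s = g t" using time_changes01_image[OF g] by (metis imageE)
    show "\<bar>y s - s * y 1\<bar> \<le> bridge_sup x + d * (2 + \<bar>x 1\<bar>)"
      using diff[OF t(1)] bridge_le_bridge_sup[OF cadlag01_bounded[OF x] t(1)] unfolding t(2) by linarith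
  qed auto
  ultimately show ?thesis by linarith
qed

lemma skorokhod_bdd_cont_compose:
  fixes g :: "real \<Rightarrow> real"
  assumes g: "continuous_on UNIV g" and b: "\<And>z. \<bar>g z\<bar> \<le> B"
    and F: "\<And>x. x \<in> cadlag01 \<Longrightarrow> \<exists>L>0. \<forall>y\<in>cadlag01. \<forall>d. skorokhod_dist x y < d \<longrightarrow> \<bar>F y - F x\<bar> \<le> d * L"
  shows "skorokhod_bdd_cont (\<lambda>x. g (F x))"
  unfolding skorokhod_bdd_cont_def
proof (intro conjI ballI allI impI)
  show "bounded ((\<lambda>x. g (F x)) ` cadlag01)" using b by (auto simp: bounded_iff)
  fix x :: "real \<Rightarrow> real" and e :: real assume x: "x \<in> cadlag01" and e: "e > 0"
  have "isCont g (F x)" using g by (auto simp: continuous_on_eq_continuous_at)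
  then obtain d where d: "d > 0" "\<And>z. \<bar>z - F x\<bar> < d \<Longrightarrow> \<bar>g z - g (F x)\<bar> < e"
    using e unfolding continuous_at_eps_delta dist_real_def by blast
  obtain L where L: "L > 0" "\<And>y d. y \<in> cadlag01 \<Longrightarrow> skorokhod_dist x y < d \<Longrightarrow> \<bar>F y - F x\<bar> \<le> d * L"
    using F[OF x] by blast
  show "\<exists>d>0. \<forall>y\<in>cadlag01. skorokhod_dist x y < d \<longrightarrow> \<bar>g (F y) - g (F x)\<bar> < e"
  \<comment> \<open>The factor 2 turns the non-strict bound for \<open>F\<close> into the strict one
    that continuity of \<open>g\<close> asks for.\<close>
  proof (intro exI[of _ "d / (2 * L)"] conjI ballI impI)
    show "0 < d / (2 * L)" using d L by auto
    fix y assume "y \<in> cadlag01" "skorokhod_dist x y < d / (2 * L)"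
    then have "\<bar>F y - F x\<bar> \<le> d / (2 * L) * L" by (rule L(2))
    also have "\<dots> < d" using d L by (simp add: field_simps)
    finally show "\<bar>g (F y) - g (F x)\<bar> < e" by (rule d(2))
  qed
qed

lemma skorokhod_bdd_cont_bridge_sup:
  fixes g :: "real \<Rightarrow> real"
  assumes "continuous_on UNIV g" and "\<And>z. \<bar>g z\<bar> \<le> B"
  shows "skorokhod_bdd_cont (\<lambda>x. g (bridge_sup x))"
proof (rule skorokhod_bdd_cont_compose[OF assms])
  fix x :: "real \<Rightarrow> real" assume "x \<in> cadlag01"
  then show "\<exists>L>0. \<forall>y\<in>cadlag01. \<forall>d. skorokhod_dist x y < d \<longrightarrow> \<bar>bridge_sup y - bridge_sup x\<bar> \<le> d * L"
    using bridge_sup_diff_le[of x] by (intro exI[of _ "2 + \<bar>x 1\<bar>"]) auto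
qed

lemma skorokhod_bdd_cont_endpoint:
  fixes g :: "real \<Rightarrow> real"
  assumes "continuous_on UNIV g" and "\<And>z. \<bar>g z\<bar> \<le> B"
  shows "skorokhod_bdd_cont (\<lambda>x. g (x 1))"
proof (rule skorokhod_bdd_cont_compose[OF assms])
  fix x :: "real \<Rightarrow> real" assume x: "x \<in> cadlag01"
  have "\<bar>y 1 - x 1\<bar> \<le> d * 1" if y: "y \<in> cadlag01" and d: "skorokhod_dist x y < d" for y d
  proof -
    obtain g where "g \<in> time_changes01" "\<bar>x 1 - y (g 1)\<bar> < d"
      using skorokhod_dist_lessE[OF x y d] by (metis atLeastAtMost_iff order_refl zero_le_one)
    then show ?thesis by (auto simp: time_changes01_def)
  qed
  then show "\<exists>L>0. \<forall>y\<in>cadlag01. \<forall>d. skorokhod_dist x y < d \<longrightarrow> \<bar>y 1 - x 1\<bar> \<le> d * L"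
    by (intro exI[of _ 1]) auto
qed

lemma bridge_sup_cmult: "c \<ge> 0 \<Longrightarrow> bounded (x ` {0..1}) \<Longrightarrow> bridge_sup (\<lambda>t. c * x t) = c * bridge_sup x"
proof -
  assume c: "c \<ge> 0" and b: "bounded (x ` {0..1})"
  have eq: "\<bar>c * x t - t * (c * x 1)\<bar> = c * \<bar>x t - t * x 1\<bar>" for t
  proof -
    have "c * x t - t * (c * x 1) = c * (x t - t * x 1)" by (simp add: algebra_simps)
    then show ?thesis using c by (simp add: abs_mult)
  qed
  have "c * bridge_sup x = (SUP t\<in>{0..1}. c * \<bar>x t - t * x 1\<bar>)"
    unfolding bridge_sup_def
    using continuous_at_Sup_mono[of "\<lambda>z. c * z" "(\<lambda>t. \<bar>x t - t * x 1\<bar>) ` {0..1}"] c bridge_bdd[OF b]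
    by (simp add: mono_def mult_left_mono image_image continuous_mult_left)
  then show ?thesis by (simp add: bridge_sup_def eq)
qed

text \<open>Right continuity reduces the supremum to rational times, a countable family.\<close>

lemma borel_measurable_bridge_sup:
  fixes Y :: "'a \<Rightarrow> real \<Rightarrow> real"
  assumes meas: "\<And>t. t \<in> {0..1} \<Longrightarrow> (\<lambda>\<omega>. Y \<omega> t) \<in> borel_measurable M"
    and rc: "\<And>\<omega> t. \<omega> \<in> space M \<Longrightarrow> t \<in> {0..<1} \<Longrightarrow> continuous (at_right t) (Y \<omega>)"
    and bdd: "\<And>\<omega>. \<omega> \<in> space M \<Longrightarrow> bounded (Y \<omega> ` {0..1})"
  shows "(\<lambda>\<omega>. bridge_sup (Y \<omega>)) \<in> borel_measurable M"
proof -
  let ?D = "\<rat> \<inter> {0..1::real}"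
  have "countable ?D" by (intro countable_Int1 countable_rat)
  have ne: "?D \<noteq> {}" by (auto intro!: exI[of _ 0])
  have dense: "bridge_sup (Y \<omega>) = (SUP t\<in>?D. \<bar>Y \<omega> t - t * Y \<omega> 1\<bar>)" if w: "\<omega> \<in> space M" for \<omega>
  proof (rule antisym)
    let ?f = "\<lambda>t. \<bar>Y \<omega> t - t * Y \<omega> 1\<bar>"
    have bd: "bdd_above (?f ` {0..1})" by (rule bridge_bdd[OF bdd[OF w]])
    have bD: "bdd_above (?f ` ?D)" by (rule bdd_above_mono[OF bd]) auto
    show "(SUP t\<in>?D. ?f t) \<le> bridge_sup (Y \<omega>)"
      unfolding bridge_sup_def by (rule cSUP_subset_mono[OF ne bd]) auto
    show "bridge_sup (Y \<omega>) \<le> (SUP t\<in>?D. ?f t)"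
      unfolding bridge_sup_def
    proof (rule cSUP_least)
      fix t :: real assume t: "t \<in> {0..1}"
      show "?f t \<le> (SUP t\<in>?D. ?f t)"
      \<comment> \<open>The endpoint has no right neighbourhood inside the interval, but 1 is itself
        rational.\<close>
      proof (cases "t = 1")
        case True then show ?thesis by (intro cSUP_upper[OF _ bD]) auto
      next
        case False
        with t have t': "t \<in> {0..<1}" by auto
        have lim: "(?f \<longlongrightarrow> ?f t) (at_right t)"
          using rc[OF w t'] unfolding continuous_within by (intro tendsto_intros)
        show ?thesis
        proof (rule field_le_epsilon)
          fix e :: real assume "e > 0"
          then have "\<forall>\<^sub>F s in at_right t. dist (?f s) (?f t) < e" by (rule tendstoD[OF lim])
          then obtain b where b: "b > t" "\<And>s. t < s \<Longrightarrow> s < b \<Longrightarrow> dist (?f s) (?f t) < e"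
            unfolding eventually_at_right_field by blast
          have "t < min b 1" using b t' by auto
          then obtain r where r: "r \<in> \<rat>" "t < r" "r < min b 1" using Rats_dense_in_real by blast
          have "?f t \<le> ?f r + e" using b(2)[of r] r by (auto simp: dist_real_def)
          also have "?f r \<le> (SUP t\<in>?D. ?f t)" using r t' by (intro cSUP_upper[OF _ bD]) auto
          finally show "?f t \<le> (SUP t\<in>?D. ?f t) + e" by simp
        qed
      qed
    qed auto
  qed
  have "(\<lambda>\<omega>. SUP t\<in>?D. \<bar>Y \<omega> t - t * Y \<omega> 1\<bar>) \<in> borel_measurable M"
  proof (rule borel_measurable_cSUP[OF \<open>countable ?D\<close>])
    fix t assume "t \<in> ?D"
    then show "(\<lambda>\<omega>. \<bar>Y \<omega> t - t * Y \<omega> 1\<bar>) \<in> borel_measurable M"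
      by (intro borel_measurable_abs borel_measurable_diff borel_measurable_times meas) auto
  next
    fix \<omega> assume "\<omega> \<in> space M"
    then show "bdd_above ((\<lambda>t. \<bar>Y \<omega> t - t * Y \<omega> 1\<bar>) ` ?D)"
      by (intro bdd_above_mono[OF bridge_bdd[OF bdd]]) auto
  qed
  then show ?thesis by (simp cong: measurable_cong add: dense)
qed

section \<open>Second and fourth moments of block sums\<close>

text \<open>Two rounds of the arithmetic-geometric mean inequality; the constant is crude because
  the bound only serves as an integrable majorant.\<close>

lemma abs_mult4_le:
  fixes a b c d :: real
  shows "\<bar>a * b * c * d\<bar> \<le> a ^ 4 + b ^ 4 + c ^ 4 + d ^ 4"
proof -
  have *: "2 * \<bar>x * y\<bar> \<le> x\<^sup>2 + y\<^sup>2" for x y :: real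
    using sum_squares_bound[of "\<bar>x\<bar>" "\<bar>y\<bar>"] by (simp add: abs_mult)
  have "2 * \<bar>a * b * (c * d)\<bar> \<le> (a * b)\<^sup>2 + (c * d)\<^sup>2" by (rule *)
  moreover have "2 * \<bar>a\<^sup>2 * b\<^sup>2\<bar> \<le> (a\<^sup>2)\<^sup>2 + (b\<^sup>2)\<^sup>2" "2 * \<bar>c\<^sup>2 * d\<^sup>2\<bar> \<le> (c\<^sup>2)\<^sup>2 + (d\<^sup>2)\<^sup>2"
    by (rule *)+
  moreover have "(x\<^sup>2)\<^sup>2 = x ^ 4" for x :: real by (simp flip: power_mult)
  moreover have "0 \<le> x ^ 4" for x :: real by simp
  ultimately show ?thesis
    by (smt (verit) power_mult_distrib mult.assoc zero_le_power2)
qed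

lemma (in prob_space) integrable_mult4:
  fixes f1 f2 f3 f4 :: "'a \<Rightarrow> real"
  assumes [measurable]: "f1 \<in> borel_measurable M" "f2 \<in> borel_measurable M"
      "f3 \<in> borel_measurable M" "f4 \<in> borel_measurable M"
    and i: "integrable M (\<lambda>\<omega>. f1 \<omega> ^ 4)" "integrable M (\<lambda>\<omega>. f2 \<omega> ^ 4)"
      "integrable M (\<lambda>\<omega>. f3 \<omega> ^ 4)" "integrable M (\<lambda>\<omega>. f4 \<omega> ^ 4)"
  shows "integrable M (\<lambda>\<omega>. f1 \<omega> * f2 \<omega> * f3 \<omega> * f4 \<omega>)"
proof (rule Bochner_Integration.integrable_bound)
  show "integrable M (\<lambda>\<omega>. f1 \<omega> ^ 4 + f2 \<omega> ^ 4 + f3 \<omega> ^ 4 + f4 \<omega> ^ 4)"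
    using i by simp
  show "AE \<omega> in M. norm (f1 \<omega> * f2 \<omega> * f3 \<omega> * f4 \<omega>) \<le> norm (f1 \<omega> ^ 4 + f2 \<omega> ^ 4 + f3 \<omega> ^ 4 + f4 \<omega> ^ 4)"
    using abs_mult4_le by (intro AE_I2) (smt (verit) real_norm_def)
qed measurable

text \<open>The left end is an integer because windows may overhang the sample on either
  side.\<close>

definition block :: "nat \<Rightarrow> int \<Rightarrow> int set" where
  "block p m = {m + 1..m + int p}"

lemma finite_block [simp]: "finite (block p m)"
  by (simp add: block_def)

lemma card_block [simp]: "card (block p m) = p"
  by (simp add: block_def)

lemma sum_block: "(\<Sum>i\<in>block p m. f i) = (\<Sum>u\<in>block p 0. f (m + u))"
  by (rule sum.reindex_bij_witness[of _ "\<lambda>u. m + u" "\<lambda>i. i - m"]) (auto simp: block_def)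

text \<open>Block sums are studied through two kernels of lags only, covariance and fourth cumulant.
  The last assumption is the definition of the cumulant solved for the moment.\<close>

locale fourth_order_seq = prob_space M for M :: "'a measure" +
  fixes Z :: "int \<Rightarrow> 'a \<Rightarrow> real" and \<gamma> :: "int \<Rightarrow> real" and \<kappa> :: "int \<Rightarrow> int \<Rightarrow> int \<Rightarrow> real"
  assumes measurable_Z [measurable]: "Z i \<in> borel_measurable M"
    and integrable_Z4: "integrable M (\<lambda>\<omega>. Z i \<omega> ^ 4)"
    and cov: "(\<integral>\<omega>. Z i \<omega> * Z j \<omega> \<partial>M) = \<gamma> (j - i)"
    and fourth: "(\<integral>\<omega>. Z i \<omega> * Z j \<omega> * Z k \<omega> * Z l \<omega> \<partial>M) =
      \<kappa> (j - i) (k - i) (l - i) + \<gamma> (j - i) * \<gamma> (l - k) + \<gamma> (k - i) * \<gamma> (l - j) + \<gamma> (l - i) * \<gamma> (k - j)"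
begin

lemma integrable_Z_mult4: "integrable M (\<lambda>\<omega>. Z i \<omega> * Z j \<omega> * Z k \<omega> * Z l \<omega>)"
  by (rule integrable_mult4) (auto intro: integrable_Z4)

lemma integrable_Z_mult2: "integrable M (\<lambda>\<omega>. Z i \<omega> * Z j \<omega>)"
  using integrable_mult4[of "Z i" "Z j" "\<lambda>_. 1" "\<lambda>_. 1"] integrable_Z4 by simp

definition S :: "int set \<Rightarrow> 'a \<Rightarrow> real" where
  "S A \<omega> = (\<Sum>i\<in>A. Z i \<omega>)"

definition R :: "int set \<Rightarrow> int set \<Rightarrow> real" where
  "R A B = (\<Sum>i\<in>A. \<Sum>k\<in>B. \<gamma> (k - i))"

text \<open>By multilinearity this is the joint cumulant of \<open>S A\<close>, \<open>S A\<close>,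
  \<open>S B\<close>, \<open>S B\<close> when \<kappa> is the fourth cumulant of centred
  variables.\<close>

definition K :: "int set \<Rightarrow> int set \<Rightarrow> real" where
  "K A B = (\<Sum>i\<in>A. \<Sum>j\<in>A. \<Sum>k\<in>B. \<Sum>l\<in>B. \<kappa> (j - i) (k - i) (l - i))"

definition G :: "nat \<Rightarrow> real" where
  "G n = (\<Sum>k\<in>{- int n..int n}. \<bar>\<gamma> k\<bar>)"

lemma measurable_S [measurable]: "S A \<in> borel_measurable M"
  unfolding S_def[abs_def] by measurable

lemma integrable_S_mult: "integrable M (\<lambda>\<omega>. S A \<omega> * S B \<omega>)"
  unfolding S_def sum_product by (intro Bochner_Integration.integrable_sum integrable_Z_mult2)

lemma integrable_S_square: "integrable M (\<lambda>\<omega>. (S A \<omega>)\<^sup>2)"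
  using integrable_S_mult[of A A] by (simp add: power2_eq_square)

lemma integral_S_mult: "(\<integral>\<omega>. S A \<omega> * S B \<omega> \<partial>M) = R A B"
  unfolding S_def R_def sum_product
  by (simp add: Bochner_Integration.integral_sum Bochner_Integration.integrable_sum integrable_Z_mult2 cov)

lemma integral_S_square: "(\<integral>\<omega>. (S A \<omega>)\<^sup>2 \<partial>M) = R A A"
  using integral_S_mult[of A A] by (simp add: power2_eq_square)

lemma S_square_mult:
  "(S A \<omega>)\<^sup>2 * (S B \<omega>)\<^sup>2 = (\<Sum>i\<in>A. \<Sum>j\<in>A. \<Sum>k\<in>B. \<Sum>l\<in>B. Z i \<omega> * Z j \<omega> * Z k \<omega> * Z l \<omega>)"
proof -
  have "(S A \<omega>)\<^sup>2 * (S B \<omega>)\<^sup>2 = (\<Sum>i\<in>A. \<Sum>j\<in>A. Z i \<omega> * Z j \<omega>) * (\<Sum>k\<in>B. \<Sum>l\<in>B. Z k \<omega> * Z l \<omega>)"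
    by (simp only: S_def power2_eq_square sum_product)
  also have "\<dots> = (\<Sum>i\<in>A. \<Sum>j\<in>A. Z i \<omega> * Z j \<omega> * (\<Sum>k\<in>B. \<Sum>l\<in>B. Z k \<omega> * Z l \<omega>))"
    by (simp only: sum_distrib_right)
  finally show ?thesis by (simp only: sum_distrib_left mult.assoc)
qed

lemma integrable_S_square_mult: "integrable M (\<lambda>\<omega>. (S A \<omega>)\<^sup>2 * (S B \<omega>)\<^sup>2)"
  unfolding S_square_mult by (intro Bochner_Integration.integrable_sum integrable_Z_mult4)

text \<open>Isserlis' formula with a cumulant correction. The pairing inside the blocks gives the
  product of second moments; the two pairings across the blocks agree after exchanging
  \<open>k\<close> and \<open>l\<close>. What exceeds the product is the covariance of the
  squares.\<close>

lemma integral_S_square_mult: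
  "(\<integral>\<omega>. (S A \<omega>)\<^sup>2 * (S B \<omega>)\<^sup>2 \<partial>M) = R A A * R B B + 2 * (R A B)\<^sup>2 + K A B"
proof -
  have "(\<integral>\<omega>. (S A \<omega>)\<^sup>2 * (S B \<omega>)\<^sup>2 \<partial>M) =
    (\<Sum>i\<in>A. \<Sum>j\<in>A. \<Sum>k\<in>B. \<Sum>l\<in>B. \<integral>\<omega>. Z i \<omega> * Z j \<omega> * Z k \<omega> * Z l \<omega> \<partial>M)"
    unfolding S_square_mult
    by (simp add: Bochner_Integration.integral_sum Bochner_Integration.integrable_sum integrable_Z_mult4)
  also have "\<dots> = K A B + (\<Sum>i\<in>A. \<Sum>j\<in>A. \<Sum>k\<in>B. \<Sum>l\<in>B. \<gamma> (j - i) * \<gamma> (l - k))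
      + (\<Sum>i\<in>A. \<Sum>j\<in>A. \<Sum>k\<in>B. \<Sum>l\<in>B. \<gamma> (k - i) * \<gamma> (l - j))
      + (\<Sum>i\<in>A. \<Sum>j\<in>A. \<Sum>k\<in>B. \<Sum>l\<in>B. \<gamma> (l - i) * \<gamma> (k - j))"
    unfolding fourth K_def by (simp add: sum.distrib)
  also have "(\<Sum>i\<in>A. \<Sum>j\<in>A. \<Sum>k\<in>B. \<Sum>l\<in>B. \<gamma> (j - i) * \<gamma> (l - k)) = R A A * R B B"
    unfolding R_def[of A] sum_distrib_right unfolding R_def sum_distrib_left ..
  also have e: "(\<Sum>i\<in>A. \<Sum>j\<in>A. \<Sum>k\<in>B. \<Sum>l\<in>B. \<gamma> (k - i) * \<gamma> (l - j)) = (R A B)\<^sup>2"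
    unfolding R_def power2_eq_square sum_product
    by (intro sum.cong refl)
  also have "(\<Sum>i\<in>A. \<Sum>j\<in>A. \<Sum>k\<in>B. \<Sum>l\<in>B. \<gamma> (l - i) * \<gamma> (k - j)) = (R A B)\<^sup>2"
    unfolding e[symmetric] by (intro sum.cong refl sum.swap)
  finally show ?thesis by simp
qed

lemma R_self_nonneg: "0 \<le> R A A"
  unfolding integral_S_square[symmetric] by simp

text \<open>Second moments of \<open>S A - S B\<close> and \<open>S A + S B\<close> are nonnegative;
  \<open>e\<close> is the sign.\<close>

lemma abs_R_le: "\<bar>R A B\<bar> \<le> (R A A + R B B) / 2"
proof -
  have le: "2 * R A B * e \<le> R A A + R B B" if "e\<^sup>2 = 1" for e
  proof -
    have "2 * R A B * e = (\<integral>\<omega>. 2 * e * (S A \<omega> * S B \<omega>) \<partial>M)"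
      by (simp add: integral_S_mult)
    also have "\<dots> \<le> (\<integral>\<omega>. (S A \<omega>)\<^sup>2 + (S B \<omega>)\<^sup>2 \<partial>M)"
    proof (rule integral_mono)
      fix \<omega>
      have "2 * (e * S A \<omega>) * S B \<omega> \<le> (e * S A \<omega>)\<^sup>2 + (S B \<omega>)\<^sup>2" by (rule sum_squares_bound)
      then show "2 * e * (S A \<omega> * S B \<omega>) \<le> (S A \<omega>)\<^sup>2 + (S B \<omega>)\<^sup>2"
        using that by (simp add: power_mult_distrib mult_ac)
    qed (auto intro!: integrable_S_mult integrable_S_square)
    also have "\<dots> = R A A + R B B"
      by (simp add: integrable_S_square integral_S_square)
    finally show ?thesis .
  qed
  show ?thesis using le[of 1] le[of "-1"] by auto
qed

lemma G_nonneg: "0 \<le> G n"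
  unfolding G_def by (simp add: sum_nonneg)

lemma sum_abs_gamma_le:
  assumes "finite B" "inj_on f B" "\<And>k. k \<in> B \<Longrightarrow> \<bar>f k\<bar> \<le> int n"
  shows "(\<Sum>k\<in>B. \<bar>\<gamma> (f k)\<bar>) \<le> G n"
proof -
  have "(\<Sum>k\<in>B. \<bar>\<gamma> (f k)\<bar>) = (\<Sum>k\<in>f ` B. \<bar>\<gamma> k\<bar>)" using assms(2) by (simp add: sum.reindex)
  also have "\<dots> \<le> G n" unfolding G_def using assms(1,3) by (intro sum_mono2) (fastforce simp: abs_le_iff)+
  finally show ?thesis .
qed

text \<open>A row-sum bound: for fixed \<open>i\<close> the lags \<open>k - i\<close> are distinct
  and at most \<open>n\<close> in modulus.\<close>

lemma R_self_le:
  assumes "finite A" "\<And>i k. i \<in> A \<Longrightarrow> k \<in> A \<Longrightarrow> \<bar>k - i\<bar> \<le> int n"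
  shows "R A A \<le> real (card A) * G n"
proof -
  have "R A A \<le> (\<Sum>i\<in>A. \<Sum>k\<in>A. \<bar>\<gamma> (k - i)\<bar>)"
    unfolding R_def by (intro sum_mono) simp
  also have "\<dots> \<le> (\<Sum>i\<in>A. G n)"
    using assms by (intro sum_mono sum_abs_gamma_le) (auto simp: inj_on_def)
  finally show ?thesis by simp
qed

text \<open>Translating the right block to the origin leaves an index set free of \<open>m\<close>,
  so a later sum over window positions can be moved innermost.\<close>

lemma R_block_right: "R A (block p m) = (\<Sum>i\<in>A. \<Sum>u\<in>block p 0. \<gamma> (m + u - i))"
  unfolding R_def sum_block[of _ p m] ..

lemma K_block_right:
  "K A (block p m) = (\<Sum>i\<in>A. \<Sum>j\<in>A. \<Sum>u\<in>block p 0. \<Sum>v\<in>block p 0. \<kappa> (j - i) (m + u - i) (m + v - i))"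
  unfolding K_def sum_block[of _ p m] ..

lemma R_block_shift: "R (block p m) (block p m) = R (block p 0) (block p 0)"
  unfolding R_def by (simp add: sum_block[of _ p m])

lemma R_block_le: "R (block p m) (block p m) \<le> real p * G p"
proof -
  have "R (block p m) (block p m) \<le> real (card (block p m)) * G p"
    by (rule R_self_le) (auto simp: block_def)
  then show ?thesis by simp
qed

lemma abs_R_block_le: "\<bar>R (block p m) (block p m')\<bar> \<le> R (block p 0) (block p 0)"
  using abs_R_le[of "block p m" "block p m'"] by (simp add: R_block_shift[of p m] R_block_shift[of p m'])

text \<open>For fixed \<open>i\<close> and \<open>u\<close> the lags \<open>m' + u - i\<close> are
  distinct as the window moves, so the sum over positions costs only \<open>G N\<close>; the
  \<open>p^2\<close> pairs of indices are counted trivially.\<close>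

lemma sum_abs_R_block_le:
  assumes I: "finite I" and N: "\<And>m'. m' \<in> I \<Longrightarrow> \<bar>m' - m\<bar> + int p \<le> int N"
  shows "(\<Sum>m'\<in>I. \<bar>R (block p m) (block p m')\<bar>) \<le> (real p)\<^sup>2 * G N"
proof -
  have "(\<Sum>m'\<in>I. \<bar>R (block p m) (block p m')\<bar>)
     \<le> (\<Sum>m'\<in>I. \<Sum>i\<in>block p m. \<Sum>u\<in>block p 0. \<bar>\<gamma> (m' + u - i)\<bar>)"
    unfolding R_block_right
    by (intro sum_mono order.trans[OF sum_abs] sum_mono order.trans[OF sum_abs]) simp
  also have "\<dots> = (\<Sum>i\<in>block p m. \<Sum>u\<in>block p 0. \<Sum>m'\<in>I. \<bar>\<gamma> (m' + u - i)\<bar>)"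
    by (subst sum.swap) (intro sum.cong refl sum.swap)
  also have "\<dots> \<le> (\<Sum>i\<in>block p m. \<Sum>u\<in>block p 0. G N)"
  proof (intro sum_mono sum_abs_gamma_le I)
    fix i u m' assume "i \<in> block p m" "u \<in> block p 0" "m' \<in> I"
    then show "\<bar>m' + u - i\<bar> \<le> int N" using N[of m'] by (auto simp: block_def)
  qed (auto simp: inj_on_def)
  finally show ?thesis by (simp add: power2_eq_square)
qed

text \<open>For fixed \<open>i\<close>, \<open>j\<close>, \<open>u\<close> the map from
  \<open>(m', v)\<close> to the lag pair is injective, so the cumulant bound absorbs two of the five
  sums, uniformly in \<open>j - i\<close>. The other three give \<open>p^3\<close>.\<close>

lemma sum_abs_K_block_le:
  assumes I: "finite I" and N: "\<And>m'. m' \<in> I \<Longrightarrow> \<bar>m' - m\<bar> + int p \<le> int N"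
    and b: "\<And>h. (\<Sum>r\<in>{-int N..int N}. \<Sum>s\<in>{-int N..int N}. \<bar>\<kappa> h r s\<bar>) \<le> b"
  shows "(\<Sum>m'\<in>I. \<bar>K (block p m) (block p m')\<bar>) \<le> (real p) ^ 3 * b"
proof -
  let ?B = "block p 0"
  have inner: "(\<Sum>m'\<in>I. \<Sum>v\<in>?B. \<bar>\<kappa> h (m' + u - i) (m' + v - i)\<bar>) \<le> b"
    if i: "i \<in> block p m" and u: "u \<in> ?B" for h i u
  proof -
    let ?f = "\<lambda>(m', v). (m' + u - i, m' + v - i)"
    have "(\<Sum>m'\<in>I. \<Sum>v\<in>?B. \<bar>\<kappa> h (m' + u - i) (m' + v - i)\<bar>)
        = (\<Sum>(m', v)\<in>I \<times> ?B. \<bar>\<kappa> h (m' + u - i) (m' + v - i)\<bar>)"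
      using I by (simp add: sum.cartesian_product)
    also have "\<dots> = (\<Sum>(r, s)\<in>?f ` (I \<times> ?B). \<bar>\<kappa> h r s\<bar>)"
      by (subst sum.reindex) (auto simp: inj_on_def intro!: sum.cong)
    also have "\<dots> \<le> (\<Sum>(r, s)\<in>{-int N..int N} \<times> {-int N..int N}. \<bar>\<kappa> h r s\<bar>)"
    proof (intro sum_mono2)
      show "?f ` (I \<times> ?B) \<subseteq> {-int N..int N} \<times> {-int N..int N}"
        using N i u by (force simp: block_def)
    qed auto
    also have "\<dots> \<le> b" using b[of h] by (simp add: sum.cartesian_product)
    finally show ?thesis .
  qed
  have "(\<Sum>m'\<in>I. \<bar>K (block p m) (block p m')\<bar>)
     \<le> (\<Sum>m'\<in>I. \<Sum>i\<in>block p m. \<Sum>j\<in>block p m. \<Sum>u\<in>?B. \<Sum>v\<in>?B. \<bar>\<kappa> (j - i) (m' + u - i) (m' + v - i)\<bar>)"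
    unfolding K_block_right
    by (intro sum_mono order.trans[OF sum_abs] sum_mono order.trans[OF sum_abs]
          sum_mono order.trans[OF sum_abs] sum_mono order.trans[OF sum_abs]) simp
  also have "\<dots> = (\<Sum>i\<in>block p m. \<Sum>m'\<in>I. \<Sum>j\<in>block p m. \<Sum>u\<in>?B. \<Sum>v\<in>?B. \<bar>\<kappa> (j - i) (m' + u - i) (m' + v - i)\<bar>)"
    by (rule sum.swap)
  also have "\<dots> = (\<Sum>i\<in>block p m. \<Sum>j\<in>block p m. \<Sum>m'\<in>I. \<Sum>u\<in>?B. \<Sum>v\<in>?B. \<bar>\<kappa> (j - i) (m' + u - i) (m' + v - i)\<bar>)"
    by (intro sum.cong refl sum.swap)
  also have "\<dots> = (\<Sum>i\<in>block p m. \<Sum>j\<in>block p m. \<Sum>u\<in>?B. \<Sum>m'\<in>I. \<Sum>v\<in>?B. \<bar>\<kappa> (j - i) (m' + u - i) (m' + v - i)\<bar>)"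
    by (intro sum.cong refl sum.swap)
  also have "\<dots> \<le> (\<Sum>i\<in>block p m. \<Sum>j\<in>block p m. \<Sum>u\<in>?B. b)"
    by (intro sum_mono inner)
  finally show ?thesis by (simp add: power3_eq_cube mult.assoc)
qed

text \<open>With both blocks equal, the cumulant bound absorbs the sums over \<open>k\<close> and
  \<open>l\<close>, and \<open>i\<close>, \<open>j\<close> leave \<open>p^2\<close>. This is the
  source of uniform integrability for squared normalised block sums.\<close>

lemma fourth_moment_block_le:
  assumes b: "\<And>h. (\<Sum>r\<in>{-int p..int p}. \<Sum>s\<in>{-int p..int p}. \<bar>\<kappa> h r s\<bar>) \<le> b"
  shows "(\<integral>\<omega>. (S (block p m) \<omega>) ^ 4 \<partial>M) \<le> 3 * (real p * G p)\<^sup>2 + (real p)\<^sup>2 * b"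
proof -
  let ?A = "block p m" and ?P = "{-int p..int p}"
  have inner: "(\<Sum>k\<in>?A. \<Sum>l\<in>?A. \<bar>\<kappa> h (k - i) (l - i)\<bar>) \<le> b" if i: "i \<in> ?A" for h i
  proof -
    have inj: "inj_on (\<lambda>k. k - i) ?A" by (auto simp: inj_on_def)
    have sub: "(\<lambda>k. k - i) ` ?A \<subseteq> ?P" using i by (auto simp: block_def)
    have "(\<Sum>k\<in>?A. \<Sum>l\<in>?A. \<bar>\<kappa> h (k - i) (l - i)\<bar>)
        = (\<Sum>r\<in>(\<lambda>k. k - i) ` ?A. \<Sum>s\<in>(\<lambda>k. k - i) ` ?A. \<bar>\<kappa> h r s\<bar>)"
      by (simp add: sum.reindex[OF inj])
    also have "\<dots> \<le> (\<Sum>r\<in>(\<lambda>k. k - i) ` ?A. \<Sum>s\<in>?P. \<bar>\<kappa> h r s\<bar>)"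
      by (intro sum_mono sum_mono2 sub) auto
    also have "\<dots> \<le> (\<Sum>r\<in>?P. \<Sum>s\<in>?P. \<bar>\<kappa> h r s\<bar>)"
      by (intro sum_mono2 sub) (auto intro: sum_nonneg)
    finally show ?thesis using b[of h] by linarith
  qed
  have "K ?A ?A \<le> (\<Sum>i\<in>?A. \<Sum>j\<in>?A. \<Sum>k\<in>?A. \<Sum>l\<in>?A. \<bar>\<kappa> (j - i) (k - i) (l - i)\<bar>)"
    unfolding K_def by (intro sum_mono) simp
  also have "\<dots> \<le> (\<Sum>i\<in>?A. \<Sum>j\<in>?A. b)" by (intro sum_mono inner)
  finally have "K ?A ?A \<le> (real p)\<^sup>2 * b" by (simp add: power2_eq_square)
  moreover have "(R ?A ?A)\<^sup>2 \<le> (real p * G p)\<^sup>2"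
    by (intro power_mono R_block_le R_self_nonneg)
  moreover have "(\<integral>\<omega>. (S ?A \<omega>) ^ 4 \<partial>M) = 3 * (R ?A ?A)\<^sup>2 + K ?A ?A"
    using integral_S_square_mult[of ?A ?A] by (simp add: power2_eq_square power4_eq_xxxx mult_ac)
  ultimately show ?thesis by simp
qed

lemma variance_sum_block_squares_le:
  assumes I: "finite I" and N: "\<And>m m'. m \<in> I \<Longrightarrow> m' \<in> I \<Longrightarrow> \<bar>m' - m\<bar> + int p \<le> int N"
    and b: "\<And>h. (\<Sum>r\<in>{-int N..int N}. \<Sum>s\<in>{-int N..int N}. \<bar>\<kappa> h r s\<bar>) \<le> b"
  defines "v \<equiv> R (block p 0) (block p 0)"
  shows "integrable M (\<lambda>\<omega>. (\<Sum>m\<in>I. (S (block p m) \<omega>)\<^sup>2 - v)\<^sup>2)"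
    and "(\<integral>\<omega>. (\<Sum>m\<in>I. (S (block p m) \<omega>)\<^sup>2 - v)\<^sup>2 \<partial>M)
      \<le> real (card I) * (2 * (real p * G p) * ((real p)\<^sup>2 * G N) + (real p) ^ 3 * b)"
proof -
  let ?Q = "\<lambda>m \<omega>. (S (block p m) \<omega>)\<^sup>2"
  have expand: "(\<Sum>m\<in>I. ?Q m \<omega> - v)\<^sup>2 = (\<Sum>m\<in>I. \<Sum>m'\<in>I. ?Q m \<omega> * ?Q m' \<omega> - v * ?Q m \<omega> - v * ?Q m' \<omega> + v * v)" for \<omega>
    unfolding power2_eq_square[of "sum _ _"] sum_product by (intro sum.cong refl) (simp add: algebra_simps)
  have int: "integrable M (\<lambda>\<omega>. ?Q m \<omega> * ?Q m' \<omega> - v * ?Q m \<omega> - v * ?Q m' \<omega> + v * v)" for m m'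
    by (intro Bochner_Integration.integrable_add Bochner_Integration.integrable_diff
        integrable_mult_right integrable_S_square_mult integrable_S_square integrable_const)
  show "integrable M (\<lambda>\<omega>. (\<Sum>m\<in>I. ?Q m \<omega> - v)\<^sup>2)"
    unfolding expand by (intro Bochner_Integration.integrable_sum int)
  \<comment> \<open>Stationarity gives all squares the same mean \<open>v\<close>, so the expanded
    terms integrate to covariances of squares.\<close>
  have cov: "(\<integral>\<omega>. ?Q m \<omega> * ?Q m' \<omega> - v * ?Q m \<omega> - v * ?Q m' \<omega> + v * v \<partial>M)
      = 2 * (R (block p m) (block p m'))\<^sup>2 + K (block p m) (block p m')" for m m'
    using integral_S_square_mult[of "block p m" "block p m'"]
    by (simp add: integrable_S_square_mult integrable_S_square integral_S_square R_block_shift[of p m] R_block_shift[of p m']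
        prob_space flip: v_def)
  have v0: "0 \<le> v" unfolding v_def by (rule R_self_nonneg)
  have vle: "v \<le> real p * G p" unfolding v_def by (rule R_block_le)
  have "(\<integral>\<omega>. (\<Sum>m\<in>I. ?Q m \<omega> - v)\<^sup>2 \<partial>M)
      = (\<Sum>m\<in>I. \<Sum>m'\<in>I. 2 * (R (block p m) (block p m'))\<^sup>2 + K (block p m) (block p m'))"
    unfolding expand
    by (subst Bochner_Integration.integral_sum, intro Bochner_Integration.integrable_sum int)
      (intro sum.cong refl, subst Bochner_Integration.integral_sum, rule int, simp add: cov)
  also have "\<dots> \<le> (\<Sum>m\<in>I. 2 * (real p * G p) * ((real p)\<^sup>2 * G N) + (real p) ^ 3 * b)"
  proof (rule sum_mono)
    fix m assume m: "m \<in> I"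
    \<comment> \<open>One factor is replaced by its uniform bound so that the other stays to the
      first power, ready to be summed over \<open>m'\<close>.\<close>
    have "(R (block p m) (block p m'))\<^sup>2 \<le> (real p * G p) * \<bar>R (block p m) (block p m')\<bar>" for m'
    proof -
      have "(R (block p m) (block p m'))\<^sup>2 = \<bar>R (block p m) (block p m')\<bar> * \<bar>R (block p m) (block p m')\<bar>"
        by (simp add: power2_eq_square)
      also have "\<dots> \<le> (real p * G p) * \<bar>R (block p m) (block p m')\<bar>"
        using abs_R_block_le[of p m m'] vle by (intro mult_right_mono) (auto simp: v_def)
      finally show ?thesis .
    qed
    then have "(\<Sum>m'\<in>I. 2 * (R (block p m) (block p m'))\<^sup>2 + K (block p m) (block p m'))
       \<le> (\<Sum>m'\<in>I. 2 * (real p * G p) * \<bar>R (block p m) (block p m')\<bar> + \<bar>K (block p m) (block p m')\<bar>)"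
      by (intro sum_mono add_mono) (auto simp: mult.assoc)
    also have "\<dots> = 2 * (real p * G p) * (\<Sum>m'\<in>I. \<bar>R (block p m) (block p m')\<bar>) + (\<Sum>m'\<in>I. \<bar>K (block p m) (block p m')\<bar>)"
      by (simp add: sum.distrib sum_distrib_left)
    also have "\<dots> \<le> 2 * (real p * G p) * ((real p)\<^sup>2 * G N) + (real p) ^ 3 * b"
      using m by (intro add_mono mult_left_mono sum_abs_R_block_le sum_abs_K_block_le[where N = N] I N b) (auto simp: G_nonneg)
    finally show "(\<Sum>m'\<in>I. 2 * (R (block p m) (block p m'))\<^sup>2 + K (block p m) (block p m'))
       \<le> 2 * (real p * G p) * ((real p)\<^sup>2 * G N) + (real p) ^ 3 * b" .
  qed
  finally show "(\<integral>\<omega>. (\<Sum>m\<in>I. ?Q m \<omega> - v)\<^sup>2 \<partial>M)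
      \<le> real (card I) * (2 * (real p * G p) * ((real p)\<^sup>2 * G N) + (real p) ^ 3 * b)" by simp
qed

end

section \<open>The Bartlett estimator as an average of squared block sums\<close>

lemma sum_int_atLeastAtMost: "(\<Sum>i\<in>{1..int n}. f i) = (\<Sum>i=1..n. f (int i))"
  by (rule sum.reindex_bij_witness[of _ int nat]) auto

text \<open>Symmetry folds the lower triangle onto the upper one, which is then listed by distance
  \<open>j\<close> and left index \<open>i\<close>. Natural subtraction empties
  \<open>{1..n-j}\<close> once \<open>j \<ge> n\<close>, so \<open>q\<close> may exceed
  \<open>n\<close>.\<close>

lemma sum_square_symmetric:
  fixes g :: "nat \<Rightarrow> nat \<Rightarrow> real"
  assumes sym: "\<And>i k. g i k = g k i" and far: "\<And>i k. i + q < k \<Longrightarrow> g i k = 0"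
  shows "(\<Sum>i=1..n. \<Sum>k=1..n. g i k) = (\<Sum>i=1..n. g i i) + 2 * (\<Sum>j=1..q. \<Sum>i=1..n-j. g i (i + j))"
proof -
  let ?N = "{1..n}"
  have "(\<Sum>i\<in>?N. \<Sum>k\<in>?N. g i k) =
      (\<Sum>i\<in>?N. \<Sum>k\<in>?N. (if i = k then g i k else 0) + (if i < k then g i k else 0) + (if k < i then g i k else 0))"
    by (intro sum.cong refl) auto
  also have "\<dots> = (\<Sum>i\<in>?N. \<Sum>k\<in>?N. if i = k then g i k else 0) + (\<Sum>i\<in>?N. \<Sum>k\<in>?N. if i < k then g i k else 0)
      + (\<Sum>i\<in>?N. \<Sum>k\<in>?N. if k < i then g i k else 0)"
    by (simp add: sum.distrib)
  also have "(\<Sum>i\<in>?N. \<Sum>k\<in>?N. if i = k then g i k else 0) = (\<Sum>i\<in>?N. g i i)"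
    by (intro sum.cong refl) (simp add: sum.delta')
  also have "(\<Sum>i\<in>?N. \<Sum>k\<in>?N. if k < i then g i k else 0) = (\<Sum>i\<in>?N. \<Sum>k\<in>?N. if i < k then g i k else 0)"
    by (subst sum.swap) (intro sum.cong refl, auto simp: sym)
  also have "(\<Sum>i\<in>?N. \<Sum>k\<in>?N. if i < k then g i k else 0) = (\<Sum>(i, k)\<in>?N \<times> ?N. if i < k then g i k else 0)"
    by (simp add: sum.cartesian_product)
  also have "\<dots> = (\<Sum>(i, k)\<in>{(i, k). i \<in> ?N \<and> k \<in> ?N \<and> i < k \<and> k \<le> i + q}. g i k)"
    using far by (intro sum.mono_neutral_cong_right) (auto split: if_splits, meson not_le)
  also have "\<dots> = (\<Sum>(j, i)\<in>Sigma {1..q} (\<lambda>j. {1..n-j}). g i (i + j))"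
    by (rule sum.reindex_bij_witness[of _ "\<lambda>(j, i). (i, i + j)" "\<lambda>(i, k). (k - i, i)"]) auto
  also have "\<dots> = (\<Sum>j=1..q. \<Sum>i=1..n-j. g i (i + j))"
    by (simp add: sum.Sigma)
  finally show ?thesis by simp
qed

text \<open>Each product of entries at distance d lies in exactly max (q + 1 - d) 0 windows of length q + 1,
  so a Bartlett-weighted sum of autocovariances is a sum of squared window sums.\<close>

lemma bartlett_window_sum:
  fixes f :: "int \<Rightarrow> real"
  shows "(\<Sum>m\<in>{- int q..<int n}. (\<Sum>i\<in>{m + 1..m + int (q + 1)} \<inter> {1..int n}. f i)\<^sup>2)
    = real (q + 1) * ((\<Sum>i=1..n. (f (int i))\<^sup>2)
       + 2 * (\<Sum>j=1..q. bartlett_weight q j * (\<Sum>i=1..n-j. f (int i) * f (int (i + j)))))"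
proof -
  let ?p = "int (q + 1)" and ?I = "{- int q..<int n}" and ?N = "{1..int n}"
  define w where "w d = max 0 (real (q + 1) - \<bar>real_of_int d\<bar>)" for d
  have count: "(\<Sum>m\<in>?I. if i \<in> {m + 1..m + ?p} \<and> k \<in> {m + 1..m + ?p} then 1 else 0) = w (k - i)"
    if "i \<in> ?N" "k \<in> ?N" for i k
  proof -
    \<comment> \<open>The window at \<open>m\<close> covers \<open>m + 1\<close> to
      \<open>m + ?p\<close>. Every window containing both indices has its \<open>m\<close> in
      \<open>?I\<close>, since \<open>i\<close> and \<open>k\<close> lie between 1 and
      \<open>n\<close>; this is why the \<open>n + q\<close> windows include those that overhang the
      sample.\<close>
    have "{m \<in> ?I. i \<in> {m + 1..m + ?p} \<and> k \<in> {m + 1..m + ?p}} = {max i k - ?p..min i k - 1}"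
      using that by auto
    then have "(\<Sum>m\<in>?I. if i \<in> {m + 1..m + ?p} \<and> k \<in> {m + 1..m + ?p} then 1 else 0)
        = real (card {max i k - ?p..min i k - 1})"
      by (simp only: sum.inter_filter[symmetric] finite_atLeastLessThan_int sum_constant mult_1_right)
    also have "\<dots> = w (k - i)"
      by (auto simp: w_def max_def min_def of_nat_nat)
    finally show ?thesis .
  qed
  have "(\<Sum>m\<in>?I. (\<Sum>i\<in>{m + 1..m + ?p} \<inter> ?N. f i)\<^sup>2)
     = (\<Sum>m\<in>?I. \<Sum>i\<in>?N. \<Sum>k\<in>?N. f i * f k * (if i \<in> {m + 1..m + ?p} \<and> k \<in> {m + 1..m + ?p} then 1 else 0))"
  proof (rule sum.cong[OF refl])
    fix m
    have "(\<Sum>i\<in>{m + 1..m + ?p} \<inter> ?N. f i) = (\<Sum>i\<in>?N. f i * (if i \<in> {m + 1..m + ?p} then 1 else 0))"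
      by (rule sum.mono_neutral_cong_left) auto
    then show "(\<Sum>i\<in>{m + 1..m + ?p} \<inter> ?N. f i)\<^sup>2
      = (\<Sum>i\<in>?N. \<Sum>k\<in>?N. f i * f k * (if i \<in> {m + 1..m + ?p} \<and> k \<in> {m + 1..m + ?p} then 1 else 0))"
      unfolding power2_eq_square by (simp only: sum_product) (intro sum.cong refl, simp)
  qed
  also have "\<dots> = (\<Sum>i\<in>?N. \<Sum>m\<in>?I. \<Sum>k\<in>?N. f i * f k * (if i \<in> {m + 1..m + ?p} \<and> k \<in> {m + 1..m + ?p} then 1 else 0))"
    by (rule sum.swap)
  also have "\<dots> = (\<Sum>i\<in>?N. \<Sum>k\<in>?N. \<Sum>m\<in>?I. f i * f k * (if i \<in> {m + 1..m + ?p} \<and> k \<in> {m + 1..m + ?p} then 1 else 0))"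
    by (intro sum.cong refl sum.swap)
  also have "\<dots> = (\<Sum>i\<in>?N. \<Sum>k\<in>?N. f i * f k * w (k - i))"
  proof (intro sum.cong refl)
    fix i k assume "i \<in> ?N" "k \<in> ?N"
    from count[OF this] show "(\<Sum>m\<in>?I. f i * f k * (if i \<in> {m + 1..m + ?p} \<and> k \<in> {m + 1..m + ?p} then 1 else 0))
       = f i * f k * w (k - i)" unfolding sum_distrib_left[symmetric] by simp
  qed
  also have "\<dots> = (\<Sum>i=1..n. \<Sum>k=1..n. f (int i) * f (int k) * w (int k - int i))"
    by (simp only: sum_int_atLeastAtMost)
  also have "\<dots> = (\<Sum>i=1..n. f (int i) * f (int i) * w (int i - int i))
      + 2 * (\<Sum>j=1..q. \<Sum>i=1..n-j. f (int i) * f (int (i + j)) * w (int (i + j) - int i))"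
    by (rule sum_square_symmetric) (auto simp: w_def abs_minus_commute mult_ac)
  also have "(\<Sum>i=1..n. f (int i) * f (int i) * w (int i - int i)) = real (q + 1) * (\<Sum>i=1..n. (f (int i))\<^sup>2)"
    unfolding sum_distrib_left by (intro sum.cong refl) (simp add: w_def power2_eq_square mult_ac)
  also have "(\<Sum>j=1..q. \<Sum>i=1..n-j. f (int i) * f (int (i + j)) * w (int (i + j) - int i))
      = real (q + 1) * (\<Sum>j=1..q. bartlett_weight q j * (\<Sum>i=1..n-j. f (int i) * f (int (i + j))))"
    unfolding sum_distrib_left
  proof (intro sum.cong refl)
    fix j i assume "j \<in> {1..q}"
    then have "w (int (i + j) - int i) = real (q + 1) * bartlett_weight q j"
      by (auto simp: w_def bartlett_weight_def field_simps)
    then show "f (int i) * f (int (i + j)) * w (int (i + j) - int i)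
       = real (q + 1) * (bartlett_weight q j * (f (int i) * f (int (i + j))))" by simp
  qed
  finally show ?thesis by (simp add: algebra_simps)
qed

text \<open>In particular the estimator is nonnegative, so its square root in \<open>kpss_T\<close>
  is a genuine one.\<close>

lemma lrv_sq_window_sum:
  "lrv_sq X q n \<omega> = (\<Sum>m\<in>{- int (q n)..<int n}.
     (\<Sum>i\<in>{m + 1..m + int (q n + 1)} \<inter> {1..int n}. X i \<omega> - sample_mean X n \<omega>)\<^sup>2) / (real n * real (q n + 1))"
  unfolding bartlett_window_sum lrv_sq_def sample_autocov_def
  by (simp add: power2_eq_square add_divide_distrib flip: sum_divide_distrib)

section \<open>Truncated, centred windows against full blocks\<close>

context fourth_order_seq
begin

text \<open>The true mean cancels in the difference of an observation and the sample mean, so these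
  are the windows of \<open>lrv_sq\<close> written in centred variables.\<close>

definition window_sum :: "nat \<Rightarrow> nat \<Rightarrow> int \<Rightarrow> 'a \<Rightarrow> real" where
  "window_sum n p m \<omega> = (\<Sum>i\<in>block p m \<inter> {1..int n}. Z i \<omega> - S {1..int n} \<omega> / real n)"

lemma block_0: "block n 0 = {1..int n}"
  by (simp add: block_def)

text \<open>Collects the two ways in which a window sum falls short of a block sum: the overhang
  beyond the sample and the centring at the sample mean.\<close>

definition window_defect :: "nat \<Rightarrow> nat \<Rightarrow> int \<Rightarrow> 'a \<Rightarrow> real" where
  "window_defect n p m \<omega> = S (block p m - {1..int n}) \<omega> + real (card (block p m \<inter> {1..int n})) / real n * S (block n 0) \<omega>"

lemma window_sum_eq: "window_sum n p m \<omega> = S (block p m) \<omega> - window_defect n p m \<omega>"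
proof -
  have "S (block p m) \<omega> = S (block p m \<inter> {1..int n}) \<omega> + S (block p m - {1..int n}) \<omega>"
    unfolding S_def by (rule sum.Int_Diff) simp
  then show ?thesis
    unfolding window_sum_def window_defect_def by (simp add: sum_subtractf S_def block_0)
qed

lemma measurable_window_defect [measurable]: "window_defect n p m \<in> borel_measurable M"
  unfolding window_defect_def[abs_def] by measurable

lemma measurable_window_sum [measurable]: "window_sum n p m \<in> borel_measurable M"
  unfolding window_sum_def[abs_def] by measurable

lemma integrable_window_defect_square: "integrable M (\<lambda>\<omega>. (window_defect n p m \<omega>)\<^sup>2)"
  unfolding window_defect_def power2_sum power_mult_distrib
  using integrable_S_mult[of "block p m - {1..int n}" "block n 0"]
  by (auto intro!: Bochner_Integration.integrable_add integrable_S_square simp: mult.left_commute mult.assoc)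

text \<open>Only edge windows pay for an overhang, which has at most \<open>p\<close> indices with
  lags at most \<open>p\<close>. Every window pays for centring, with weight at most
  \<open>p / n\<close> on the full sum. The factors 2 come from splitting the square of a
  sum.\<close>

lemma integral_window_defect_square_le:
  "(\<integral>\<omega>. (window_defect n p m \<omega>)\<^sup>2 \<partial>M) \<le> 2 * (if block p m \<subseteq> {1..int n} then 0 else real p * G p)
     + 2 * ((real p / real n)\<^sup>2 * (real n * G n))"
proof -
  let ?A = "block p m - {1..int n}" and ?c = "real (card (block p m \<inter> {1..int n})) / real n"
  have c: "?c\<^sup>2 \<le> (real p / real n)\<^sup>2"
    using card_mono[of "block p m" "block p m \<inter> {1..int n}"] by (intro power_mono divide_right_mono) auto
  have "R ?A ?A \<le> (if block p m \<subseteq> {1..int n} then 0 else real p * G p)"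
  proof (cases "block p m \<subseteq> {1..int n}")
    case True then show ?thesis by (simp add: R_def Diff_eq_empty_iff[THEN iffD2])
  next
    case False
    have "R ?A ?A \<le> real (card ?A) * G p" by (rule R_self_le) (auto simp: block_def)
    also have "\<dots> \<le> real p * G p"
      using card_mono[of "block p m" ?A] by (intro mult_right_mono G_nonneg) auto
    finally show ?thesis using False by simp
  qed
  moreover have "?c\<^sup>2 * R (block n 0) (block n 0) \<le> (real p / real n)\<^sup>2 * (real n * G n)"
    by (intro mult_mono c R_block_le R_self_nonneg) auto
  moreover have "(\<integral>\<omega>. (window_defect n p m \<omega>)\<^sup>2 \<partial>M) \<le> (\<integral>\<omega>. 2 * (S ?A \<omega>)\<^sup>2 + 2 * (?c\<^sup>2 * (S (block n 0) \<omega>)\<^sup>2) \<partial>M)"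
  proof (rule integral_mono)
    fix \<omega>
    have "(x + y)\<^sup>2 \<le> 2 * x\<^sup>2 + 2 * y\<^sup>2" for x y :: real
      using sum_squares_bound[of x y] by (simp add: power2_sum)
    then show "(window_defect n p m \<omega>)\<^sup>2 \<le> 2 * (S ?A \<omega>)\<^sup>2 + 2 * (?c\<^sup>2 * (S (block n 0) \<omega>)\<^sup>2)"
      unfolding window_defect_def power_mult_distrib[symmetric] .
  qed (auto intro!: integrable_window_defect_square Bochner_Integration.integrable_add integrable_S_square)
  moreover have "\<dots> = 2 * R ?A ?A + 2 * (?c\<^sup>2 * R (block n 0) (block n 0))"
    by (simp add: integrable_S_square integral_S_square)
  ultimately show ?thesis by linarith
qed

lemma sum_integral_window_defect_square_le:
  assumes n: "n > 0"
  shows "(\<Sum>m\<in>{- int q..<int n}. \<integral>\<omega>. (window_defect n (q + 1) m \<omega>)\<^sup>2 \<partial>M)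
    \<le> 4 * real q * (real (q + 1) * G (q + 1)) + 2 * real (n + q) * ((real (q + 1) / real n)\<^sup>2 * (real n * G n))"
proof -
  let ?I = "{- int q..<int n}" and ?p = "q + 1"
  let ?E = "{m \<in> ?I. \<not> block ?p m \<subseteq> {1..int n}}"
  \<comment> \<open>At most \<open>q\<close> windows overhang on each side: on the right,
    \<open>m + q + 1 > n\<close> means \<open>m \<ge> n - q\<close>.\<close>
  have "?E \<subseteq> {- int q..-1} \<union> {int n - int q..int n - 1}"
    by (auto simp: block_def)
  then have "card ?E \<le> card ({- int q..-1} \<union> {int n - int q..int n - 1})" by (intro card_mono) auto
  also have "\<dots> \<le> card {- int q..-1} + card {int n - int q..int n - 1}" by (rule card_Un_le)
  also have "\<dots> \<le> 2 * q" by simp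
  finally have E: "real (card ?E) \<le> 2 * real q" by linarith
  have "(\<Sum>m\<in>?I. \<integral>\<omega>. (window_defect n ?p m \<omega>)\<^sup>2 \<partial>M)
      \<le> (\<Sum>m\<in>?I. 2 * (if block ?p m \<subseteq> {1..int n} then 0 else real ?p * G ?p) + 2 * ((real ?p / real n)\<^sup>2 * (real n * G n)))"
    by (intro sum_mono integral_window_defect_square_le)
  also have "\<dots> = 2 * (\<Sum>m\<in>?I. if \<not> block ?p m \<subseteq> {1..int n} then real ?p * G ?p else 0)
      + real (card ?I) * (2 * ((real ?p / real n)\<^sup>2 * (real n * G n)))"
    unfolding sum.distrib sum_distrib_left by (intro arg_cong2[where f = "(+)"] sum.cong) auto
  also have "(\<Sum>m\<in>?I. if \<not> block ?p m \<subseteq> {1..int n} then real ?p * G ?p else 0) = real (card ?E) * (real ?p * G ?p)"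
    by (subst sum.inter_filter[symmetric]) auto
  also have "real (card ?E) * (real ?p * G ?p) \<le> 2 * real q * (real ?p * G ?p)"
    using E by (intro mult_right_mono) (auto simp: G_nonneg)
  also have "real (card ?I) = real (n + q)" by simp
  finally show ?thesis by (simp add: algebra_simps)
qed

end

text \<open>A form of Young's inequality. It turns second-moment bounds into first-moment bounds
  without taking roots of integrals.\<close>

lemma abs_le_eps_plus_square:
  fixes u t :: real
  assumes "t > 0"
  shows "\<bar>u\<bar> \<le> t + u\<^sup>2 / t"
proof -
  have "2 * \<bar>u\<bar> * t \<le> u\<^sup>2 + t\<^sup>2" using sum_squares_bound[of "\<bar>u\<bar>" t] by simp
  moreover have "0 \<le> \<bar>u\<bar> * t" using assms by simp
  ultimately have "\<bar>u\<bar> * t \<le> u\<^sup>2 + t\<^sup>2" by linarith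
  then show ?thesis using assms by (simp add: field_simps power2_eq_square)
qed

context fourth_order_seq
begin

text \<open>A bound in mean at finite \<open>n\<close>: \<open>T\<close> is the order of the sum of
  squares, \<open>\<rho>\<close> the relative error, and \<open>e\<close> a free Young parameter.
  Its inverse multiplies only \<open>\<rho>\<close>, so it can be sent to 0 after \<open>n\<close>
  tends to infinity.\<close>

lemma window_squares_bound:
  fixes H C e :: real and n q :: nat
  assumes H: "1/2 < H" "H < 1" and C: "0 \<le> C" and e: "0 < e" and qn: "q + 1 \<le> n"
    and G: "\<And>n. n \<ge> 1 \<Longrightarrow> G n \<le> C * real n powr (2 * H - 1)"
    and K: "\<And>n h. n \<ge> 1 \<Longrightarrow> (\<Sum>r\<in>{-int n..int n}. \<Sum>s\<in>{-int n..int n}. \<bar>\<kappa> h r s\<bar>) \<le> C * real n powr (2 * H - 1)"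
  defines "p \<equiv> q + 1"
  defines "T \<equiv> real n * real p powr (2 * H)" and "\<rho> \<equiv> (real p / real n) powr (2 - 2 * H)"
    and "v \<equiv> R (block p 0) (block p 0)"
  shows "integrable M (\<lambda>\<omega>. \<bar>(\<Sum>m\<in>{- int q..<int n}. (window_sum n p m \<omega>)\<^sup>2) / T - real (n + q) * v / T\<bar>)" (is ?thesis1)
    and "(\<integral>\<omega>. \<bar>(\<Sum>m\<in>{- int q..<int n}. (window_sum n p m \<omega>)\<^sup>2) / T - real (n + q) * v / T\<bar> \<partial>M)
      \<le> ((1 + 1 / e) * (8 * C) + 6 * (2 * C\<^sup>2 + C) / e) * \<rho> + (2 * C + 1) * e" (is ?thesis2)
proof -
  let ?I = "{- int q..<int n}"
  let ?U = "\<lambda>\<omega>. \<Sum>m\<in>?I. (S (block p m) \<omega>)\<^sup>2 - v"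
  \<comment> \<open>A pointwise majorant: the squared defects with their share of the cross terms,
    the block squares paying for the rest of the cross terms, and Young's bound with
    \<open>t = e * T\<close> for the fluctuation \<open>?U\<close>.\<close>
  let ?B = "\<lambda>\<omega>. (1 + 1 / e) * (\<Sum>m\<in>?I. (window_defect n p m \<omega>)\<^sup>2) + e * (\<Sum>m\<in>?I. (S (block p m) \<omega>)\<^sup>2) + e * T + (?U \<omega>)\<^sup>2 / (e * T)"
  define x where "x = real p powr (2 * H)"
  define y where "y = real n powr (2 * H - 1)"
  have n: "n \<ge> 1" and p: "p \<ge> 1" and pn: "real p \<le> real n" using qn by (auto simp: p_def)
  have x: "x > 0" and y: "y > 0" using n p by (auto simp: x_def y_def)
  have T: "T = real n * x" by (simp add: T_def x_def)
  have T0: "T > 0" using n x by (simp add: T)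
  have px: "real p * real p powr (2 * H - 1) = x"
    using p by (simp add: x_def powr_diff)
  have Gp: "real p * G p \<le> C * x"
  proof -
    have "real p * G p \<le> real p * (C * real p powr (2 * H - 1))" using G[OF p] by (intro mult_left_mono) auto
    then show ?thesis using px by (simp add: mult_ac)
  qed
  \<comment> \<open>Towards the identity \<open>rT\<close>, which explains the exponent in
    \<open>\<rho>\<close>: it makes \<open>p^2 n^(2H-1)\<close> equal to
    \<open>\<rho> * T\<close>.\<close>
  have "\<rho> * real n powr (2 - 2 * H) * x = real p powr (2 - 2 * H) * x"
    using n p by (simp add: \<rho>_def powr_divide)
  also have "\<dots> = (real p)\<^sup>2" using p by (simp add: x_def powr_numeral flip: powr_add)
  finally have "(real p)\<^sup>2 * y = \<rho> * x * (real n powr (2 - 2 * H) * y)" by (simp only: mult_ac)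
  moreover have "real n powr (2 - 2 * H) * y = real n" using n by (simp add: y_def flip: powr_add)
  ultimately have rT: "(real p)\<^sup>2 * y = \<rho> * T" by (simp only: T mult_ac)
  \<comment> \<open>The edge windows contribute the order \<open>p * x\<close>, a fraction
    \<open>p / n\<close> of \<open>T\<close>; as \<open>p / n \<le> 1\<close> and
    \<open>2 - 2 * H < 1\<close>, this is dominated by \<open>\<rho>\<close>.\<close>
  have "real p / real n = (real p / real n) powr 1" using n p by simp
  also have "\<dots> \<le> \<rho>" unfolding \<rho>_def using H n p pn by (intro powr_mono') auto
  finally have pr: "real p * x \<le> \<rho> * T" using n x by (simp add: T field_simps)
  have r0: "0 \<le> \<rho>" by (simp add: \<rho>_def)
  \<comment> \<open>Since \<open>2 * H > 1\<close>, one factor \<open>p\<close> of the cumulant term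
    can be raised to \<open>p powr (2 * H)\<close>, giving it the form of the Gaussian term.\<close>
  have pxle: "real p \<le> x"
  proof -
    have "real p powr 1 \<le> real p powr (2 * H)" using p H by (intro powr_mono) auto
    then show ?thesis using p by (simp add: x_def)
  qed
  have nq: "real (n + q) \<le> 2 * real n" using qn by simp
  \<comment> \<open>Lags between points of two windows stay below
    \<open>n + 2 * q \<le> 3 * n\<close>; the constant is harmless because the exponent
    \<open>2 * H - 1\<close> is below 1.\<close>
  have y3: "real (3 * n) powr (2 * H - 1) \<le> 3 * y"
  proof -
    have "real (3 * n) powr (2 * H - 1) = 3 powr (2 * H - 1) * y" by (simp add: y_def powr_mult)
    also have "\<dots> \<le> 3 powr 1 * y" using H y by (intro mult_right_mono powr_mono) auto
    finally show ?thesis by simp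
  qed
  have G3: "G (3 * n) \<le> C * (3 * y)"
    using G[of "3 * n"] n mult_left_mono[OF y3 C] by auto
  have K3: "(\<Sum>r\<in>{-int (3 * n)..int (3 * n)}. \<Sum>s\<in>{-int (3 * n)..int (3 * n)}. \<bar>\<kappa> h r s\<bar>) \<le> C * (3 * y)" for h
    using K[of "3 * n" h] n mult_left_mono[OF y3 C] by (auto intro: order.trans)
  have N: "\<bar>m' - m\<bar> + int p \<le> int (3 * n)" if "m \<in> ?I" "m' \<in> ?I" for m m'
    using that qn by (auto simp: p_def)
  note U = variance_sum_block_squares_le[of ?I p "3 * n" "C * (3 * y)", OF _ N K3, folded v_def]
  have intB: "integrable M ?B"
    by (intro Bochner_Integration.integrable_add integrable_mult_right Bochner_Integration.integrable_sum
        integrable_window_defect_square integrable_S_square integrable_const integrable_divide U(1)) auto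
  have pointwise: "\<bar>(\<Sum>m\<in>?I. (window_sum n p m \<omega>)\<^sup>2) / T - real (n + q) * v / T\<bar> \<le> ?B \<omega> / T" for \<omega>
  proof -
    have AD: "window_sum n p m \<omega> = S (block p m) \<omega> - window_defect n p m \<omega>" for m by (rule window_sum_eq)
    have one: "\<bar>(window_sum n p m \<omega>)\<^sup>2 - (S (block p m) \<omega>)\<^sup>2\<bar> \<le> (1 + 1 / e) * (window_defect n p m \<omega>)\<^sup>2 + e * (S (block p m) \<omega>)\<^sup>2" for m
    proof -
      let ?s = "S (block p m) \<omega>" and ?d = "window_defect n p m \<omega>"
      have "2 * \<bar>e * ?s\<bar> * \<bar>?d\<bar> \<le> (e * ?s)\<^sup>2 + ?d\<^sup>2" using sum_squares_bound[of "\<bar>e * ?s\<bar>" "\<bar>?d\<bar>"] by simp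
      also have "(e * ?s)\<^sup>2 + ?d\<^sup>2 = e * (e * ?s\<^sup>2 + ?d\<^sup>2 / e)"
        using e by (simp add: power_mult_distrib power2_eq_square distrib_left)
      also have "2 * \<bar>e * ?s\<bar> * \<bar>?d\<bar> = e * (2 * \<bar>?s * ?d\<bar>)" using e by (simp add: abs_mult)
      finally have "e * (2 * \<bar>?s * ?d\<bar>) \<le> e * (e * ?s\<^sup>2 + ?d\<^sup>2 / e)" .
      then have "2 * \<bar>?s * ?d\<bar> \<le> e * ?s\<^sup>2 + ?d\<^sup>2 / e" using e by simp
      moreover have "(window_sum n p m \<omega>)\<^sup>2 - ?s\<^sup>2 = ?d\<^sup>2 - 2 * (?s * ?d)"
        unfolding AD by (simp add: power2_diff)
      moreover have "(1 + 1 / e) * ?d\<^sup>2 + e * ?s\<^sup>2 = ?d\<^sup>2 + (e * ?s\<^sup>2 + ?d\<^sup>2 / e)" by (simp add: algebra_simps)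
      moreover have "0 \<le> ?d\<^sup>2" by simp
      ultimately show ?thesis by linarith
    qed
    have "real (card ?I) = real (n + q)" by simp
    then have "(\<Sum>m\<in>?I. (window_sum n p m \<omega>)\<^sup>2) - real (n + q) * v
       = (\<Sum>m\<in>?I. (window_sum n p m \<omega>)\<^sup>2 - (S (block p m) \<omega>)\<^sup>2) + ?U \<omega>"
      by (simp add: sum_subtractf)
    also have "\<bar>\<dots>\<bar> \<le> (\<Sum>m\<in>?I. \<bar>(window_sum n p m \<omega>)\<^sup>2 - (S (block p m) \<omega>)\<^sup>2\<bar>) + \<bar>?U \<omega>\<bar>"
      by (intro order.trans[OF abs_triangle_ineq] add_right_mono sum_abs)
    also have "\<dots> \<le> (\<Sum>m\<in>?I. (1 + 1 / e) * (window_defect n p m \<omega>)\<^sup>2 + e * (S (block p m) \<omega>)\<^sup>2) + (e * T + (?U \<omega>)\<^sup>2 / (e * T))"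
      using e T0 by (intro add_mono sum_mono one abs_le_eps_plus_square) auto
    also have "\<dots> = ?B \<omega>" by (simp add: sum.distrib sum_distrib_left)
    finally have "\<bar>(\<Sum>m\<in>?I. (window_sum n p m \<omega>)\<^sup>2) - real (n + q) * v\<bar> / T \<le> ?B \<omega> / T"
      using T0 by (intro divide_right_mono) auto
    then show ?thesis using T0 by (simp add: abs_divide flip: diff_divide_distrib)
  qed
  show 1: ?thesis1
  proof (rule Bochner_Integration.integrable_bound[OF integrable_divide[OF intB, of T]])
    show "AE \<omega> in M. norm \<bar>(\<Sum>m\<in>?I. (window_sum n p m \<omega>)\<^sup>2) / T - real (n + q) * v / T\<bar> \<le> norm (?B \<omega> / T)"
      using order.trans[OF pointwise abs_ge_self] by (simp only: real_norm_def abs_abs AE_I2)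
  qed measurable
  have "(\<integral>\<omega>. \<bar>(\<Sum>m\<in>?I. (window_sum n p m \<omega>)\<^sup>2) / T - real (n + q) * v / T\<bar> \<partial>M) \<le> (\<integral>\<omega>. ?B \<omega> / T \<partial>M)"
    by (rule integral_mono[OF 1 integrable_divide[OF intB] pointwise])
  also have "\<dots> = (\<integral>\<omega>. ?B \<omega> \<partial>M) / T" by simp
  also have "(\<integral>\<omega>. ?B \<omega> \<partial>M) = (1 + 1 / e) * (\<Sum>m\<in>?I. \<integral>\<omega>. (window_defect n p m \<omega>)\<^sup>2 \<partial>M) + e * (real (n + q) * v) + e * T
      + (\<integral>\<omega>. (?U \<omega>)\<^sup>2 \<partial>M) / (e * T)"
  proof -
    have iD: "integrable M (\<lambda>\<omega>. (1 + 1 / e) * (\<Sum>m\<in>?I. (window_defect n p m \<omega>)\<^sup>2))"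
      by (intro integrable_mult_right Bochner_Integration.integrable_sum integrable_window_defect_square)
    have iS: "integrable M (\<lambda>\<omega>. e * (\<Sum>m\<in>?I. (S (block p m) \<omega>)\<^sup>2))"
      by (intro integrable_mult_right Bochner_Integration.integrable_sum integrable_S_square)
    have iU: "integrable M (\<lambda>\<omega>. (?U \<omega>)\<^sup>2 / (e * T))" by (intro integrable_divide U(1)) auto
    have "(\<integral>\<omega>. ?B \<omega> \<partial>M) = (\<integral>\<omega>. (1 + 1 / e) * (\<Sum>m\<in>?I. (window_defect n p m \<omega>)\<^sup>2) \<partial>M)
        + (\<integral>\<omega>. e * (\<Sum>m\<in>?I. (S (block p m) \<omega>)\<^sup>2) \<partial>M) + (\<integral>\<omega>. e * T \<partial>M) + (\<integral>\<omega>. (?U \<omega>)\<^sup>2 / (e * T) \<partial>M)"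
      by (simp only: iD iS iU Bochner_Integration.integral_add Bochner_Integration.integrable_add integrable_const)
    also have "(\<integral>\<omega>. e * (\<Sum>m\<in>?I. (S (block p m) \<omega>)\<^sup>2) \<partial>M) = e * (real (n + q) * v)"
    proof -
      have "(\<integral>\<omega>. (\<Sum>m\<in>?I. (S (block p m) \<omega>)\<^sup>2) \<partial>M) = (\<Sum>m\<in>?I. v)"
        by (subst Bochner_Integration.integral_sum[OF integrable_S_square])
          (intro sum.cong refl, simp only: integral_S_square v_def, rule R_block_shift)
      then show ?thesis by simp
    qed
    also have "(\<integral>\<omega>. (1 + 1 / e) * (\<Sum>m\<in>?I. (window_defect n p m \<omega>)\<^sup>2) \<partial>M) = (1 + 1 / e) * (\<Sum>m\<in>?I. \<integral>\<omega>. (window_defect n p m \<omega>)\<^sup>2 \<partial>M)"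
      by (simp add: integrable_window_defect_square)
    finally show ?thesis by (simp add: prob_space)
  qed
  also have "\<dots> \<le> (1 + 1 / e) * (8 * C * (\<rho> * T)) + e * (2 * C * T) + e * T + (6 * (2 * C\<^sup>2 + C) * (\<rho> * T * T)) / (e * T)"
  proof (intro add_mono mult_left_mono divide_right_mono)
    have "(\<Sum>m\<in>?I. \<integral>\<omega>. (window_defect n p m \<omega>)\<^sup>2 \<partial>M)
      \<le> 4 * real q * (real p * G p) + 2 * real (n + q) * ((real p / real n)\<^sup>2 * (real n * G n))"
      unfolding p_def using n by (intro sum_integral_window_defect_square_le) auto
    also have "\<dots> \<le> 4 * real p * (C * x) + 2 * (2 * real n) * ((real p / real n)\<^sup>2 * (real n * (C * y)))"
      using Gp G[OF n] nq by (intro add_mono mult_mono Gp) (auto simp: p_def y_def G_nonneg)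
    also have "\<dots> = 4 * C * (real p * x) + 4 * C * ((real p)\<^sup>2 * y)"
      using n by (simp add: field_simps power2_eq_square)
    also have "\<dots> \<le> 4 * C * (\<rho> * T) + 4 * C * (\<rho> * T)"
      unfolding rT using pr C r0 by (intro add_mono mult_left_mono) auto
    finally show "(\<Sum>m\<in>?I. \<integral>\<omega>. (window_defect n p m \<omega>)\<^sup>2 \<partial>M) \<le> 8 * C * (\<rho> * T)" by (simp add: mult_ac)
    have "real (n + q) * v \<le> (2 * real n) * (C * x)"
      using R_block_le[of p 0] Gp nq by (intro mult_mono) (auto simp: v_def R_self_nonneg)
    then show "real (n + q) * v \<le> 2 * C * T" by (simp add: T mult_ac)
    have "(\<integral>\<omega>. (?U \<omega>)\<^sup>2 \<partial>M) \<le> real (card ?I) * (2 * (real p * G p) * ((real p)\<^sup>2 * G (3 * n)) + (real p) ^ 3 * (C * (3 * y)))"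
      by (rule U(2)) auto
    also have "\<dots> = real (n + q) * (2 * (real p * G p) * ((real p)\<^sup>2 * G (3 * n)) + (real p)\<^sup>2 * real p * (C * (3 * y)))"
      by (simp add: power2_eq_square power3_eq_cube)
    also have "\<dots> \<le> (2 * real n) * (2 * (C * x) * ((real p)\<^sup>2 * (C * (3 * y))) + (real p)\<^sup>2 * x * (C * (3 * y)))"
      using C x y by (intro nq Gp G3 pxle mult_mono add_mono) (auto simp: G_nonneg)
    also have "\<dots> = 6 * (2 * C\<^sup>2 + C) * (((real p)\<^sup>2 * y) * (real n * x))"
      by (simp add: algebra_simps power2_eq_square)
    finally show "(\<integral>\<omega>. (?U \<omega>)\<^sup>2 \<partial>M) \<le> 6 * (2 * C\<^sup>2 + C) * (\<rho> * T * T)" unfolding rT by (simp add: T)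
  qed (use e T0 in auto)
  also have "\<dots> = (((1 + 1 / e) * (8 * C) + 6 * (2 * C\<^sup>2 + C) / e) * \<rho> + (2 * C + 1) * e) * T"
    using e T0 by (simp add: field_simps)
  finally show ?thesis2 using T0 by (simp add: divide_right_mono pos_divide_le_eq)
qed

lemma window_squares_tendsto:
  fixes H C c2 :: real and q :: "nat \<Rightarrow> nat"
  assumes H: "1/2 < H" "H < 1" and C: "0 \<le> C"
    and G: "\<And>n. n \<ge> 1 \<Longrightarrow> G n \<le> C * real n powr (2 * H - 1)"
    and K: "\<And>n h. n \<ge> 1 \<Longrightarrow> (\<Sum>r\<in>{-int n..int n}. \<Sum>s\<in>{-int n..int n}. \<bar>\<kappa> h r s\<bar>) \<le> C * real n powr (2 * H - 1)"
    and q: "filterlim q at_top sequentially" "(\<lambda>n. real (q n) / real n) \<longlonglongrightarrow> 0"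
    and v: "(\<lambda>p. R (block p 0) (block p 0) / real p powr (2 * H)) \<longlonglongrightarrow> c2"
  defines "Q \<equiv> \<lambda>n \<omega>. (\<Sum>m\<in>{- int (q n)..<int n}. (window_sum n (q n + 1) m \<omega>)\<^sup>2) / (real n * real (q n + 1) powr (2 * H))"
  shows "\<forall>\<^sub>F n in sequentially. integrable M (\<lambda>\<omega>. \<bar>Q n \<omega> - c2\<bar>)"
    and "(\<lambda>n. \<integral>\<omega>. \<bar>Q n \<omega> - c2\<bar> \<partial>M) \<longlonglongrightarrow> 0"
proof -
  define p where "p n = q n + 1" for n
  define \<rho> where "\<rho> n = (real (p n) / real n) powr (2 - 2 * H)" for n
  define T where "T n = real n * real (p n) powr (2 * H)" for n
  define w where "w n = real (n + q n) * R (block (p n) 0) (block (p n) 0) / T n" for n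
  have Q: "Q n \<omega> = (\<Sum>m\<in>{- int (q n)..<int n}. (window_sum n (p n) m \<omega>)\<^sup>2) / T n" for n \<omega>
    by (simp add: Q_def p_def T_def)
  have p_top: "filterlim p at_top sequentially"
    using filterlim_compose[OF filterlim_add_const_nat_at_top[of 1] q(1)] by (simp add: p_def[abs_def])
  have inv: "(\<lambda>n. 1 / real n) \<longlonglongrightarrow> 0" by (rule lim_1_over_n)
  have pn: "(\<lambda>n. real (p n) / real n) \<longlonglongrightarrow> 0"
    using tendsto_add[OF q(2) inv] by (simp add: p_def add_divide_distrib add.commute)
  have rho: "\<rho> \<longlonglongrightarrow> 0"
    unfolding \<rho>_def[abs_def] using pn H by (intro tendsto_zero_powrI[where b = "2 - 2 * H"]) auto
  have big: "\<forall>\<^sub>F n in sequentially. n > 0 \<and> q n + 1 \<le> n"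
  proof -
    have "\<forall>\<^sub>F n in sequentially. real (p n) / real n < 1" using order_tendstoD(2)[OF pn] by simp
    then show ?thesis using eventually_gt_at_top[of 0]
    proof eventually_elim
      case (elim n) then show ?case by (simp add: p_def field_simps)
    qed
  qed
  \<comment> \<open>The \<open>n + q\<close> windows are normalised by \<open>n\<close>, and the
    excess \<open>q / n\<close> vanishes; the rest is the hypothesis on a single block, read along
    \<open>p n\<close>.\<close>
  have "(\<lambda>n. (1 + real (q n) / real n) * (R (block (p n) 0) (block (p n) 0) / real (p n) powr (2 * H))) \<longlonglongrightarrow> (1 + 0) * c2"
    by (intro tendsto_intros q(2) filterlim_compose[OF v p_top])
  moreover have "\<forall>\<^sub>F n in sequentially. (1 + real (q n) / real n) * (R (block (p n) 0) (block (p n) 0) / real (p n) powr (2 * H)) = w n"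
    using eventually_gt_at_top[of 0] by eventually_elim (simp add: w_def T_def field_simps)
  ultimately have w: "w \<longlonglongrightarrow> c2" using Lim_transform_eventually by fastforce
  have bnd: "\<forall>\<^sub>F n in sequentially. integrable M (\<lambda>\<omega>. \<bar>Q n \<omega> - c2\<bar>) \<and> (\<integral>\<omega>. \<bar>Q n \<omega> - c2\<bar> \<partial>M)
      \<le> ((1 + 1 / e) * (8 * C) + 6 * (2 * C\<^sup>2 + C) / e) * \<rho> n + (2 * C + 1) * e + \<bar>w n - c2\<bar>" if e: "e > 0" for e
    using big
  proof eventually_elim
    case (elim n)
    note W = window_squares_bound[OF H C e, of "q n" n, OF _ G K, folded p_def, folded T_def \<rho>_def, folded w_def, folded Q]
    have i1: "integrable M (\<lambda>\<omega>. \<bar>Q n \<omega> - w n\<bar>)" using W(1) elim by (simp add: p_def)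
    have i2: "integrable M (\<lambda>\<omega>. \<bar>Q n \<omega> - w n\<bar> + \<bar>w n - c2\<bar>)" using i1 by simp
    have i3: "integrable M (\<lambda>\<omega>. \<bar>Q n \<omega> - c2\<bar>)"
      by (rule Bochner_Integration.integrable_bound[OF i2]) (auto simp: Q)
    have "(\<integral>\<omega>. \<bar>Q n \<omega> - c2\<bar> \<partial>M) \<le> (\<integral>\<omega>. \<bar>Q n \<omega> - w n\<bar> + \<bar>w n - c2\<bar> \<partial>M)"
      by (rule integral_mono[OF i3 i2]) simp
    also have "\<dots> = (\<integral>\<omega>. \<bar>Q n \<omega> - w n\<bar> \<partial>M) + \<bar>w n - c2\<bar>"
      using i1 by (simp add: prob_space)
    finally show ?case using W(2) elim i3 by (simp add: p_def)
  qed
  show "\<forall>\<^sub>F n in sequentially. integrable M (\<lambda>\<omega>. \<bar>Q n \<omega> - c2\<bar>)"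
    using bnd[of 1] by (auto elim: eventually_mono)
  show "(\<lambda>n. \<integral>\<omega>. \<bar>Q n \<omega> - c2\<bar> \<partial>M) \<longlonglongrightarrow> 0"
  proof (rule tendstoI)
    fix \<epsilon> :: real assume eps: "\<epsilon> > 0"
    \<comment> \<open>The part of the bound that does not vanish, \<open>(2 * C + 1) * e\<close>,
      becomes half of \<open>\<epsilon>\<close>. The coefficient of \<open>\<rho>\<close> is then
      fixed.\<close>
    define e where "e = \<epsilon> / (2 * (2 * C + 1))"
    have e: "e > 0" using eps C by (simp add: e_def)
    have ce: "(2 * C + 1) * e = \<epsilon> / 2" using C by (simp add: e_def field_simps)
    let ?b = "\<lambda>n. ((1 + 1 / e) * (8 * C) + 6 * (2 * C\<^sup>2 + C) / e) * \<rho> n + (2 * C + 1) * e + \<bar>w n - c2\<bar>"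
    have "?b \<longlonglongrightarrow> ((1 + 1 / e) * (8 * C) + 6 * (2 * C\<^sup>2 + C) / e) * 0 + (2 * C + 1) * e + \<bar>c2 - c2\<bar>"
      by (intro tendsto_intros rho w)
    from order_tendstoD(2)[OF this, of \<epsilon>] have "\<forall>\<^sub>F n in sequentially. ?b n < \<epsilon>"
      using eps by (simp add: ce)
    then show "\<forall>\<^sub>F n in sequentially. dist (\<integral>\<omega>. \<bar>Q n \<omega> - c2\<bar> \<partial>M) 0 < \<epsilon>"
      using bnd[OF e]
    proof eventually_elim
      case (elim n)
      have "0 \<le> (\<integral>\<omega>. \<bar>Q n \<omega> - c2\<bar> \<partial>M)" by simp
      then show ?case using elim by (simp add: dist_real_def)
    qed
  qed
qed

end

section \<open>Convergence of moments and Slutsky arguments\<close>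

text \<open>Uniform integrability by truncation: \<open>min (z^2) k\<close> is bounded and
  continuous, and the part cut off is at most \<open>z^4 / k\<close>, hence at most
  \<open>B / k\<close> in mean for all \<open>n \<ge> 1\<close>.\<close>

lemma (in prob_space) second_moment_tendsto:
  fixes Y :: "nat \<Rightarrow> 'a \<Rightarrow> real" and V :: "'b \<Rightarrow> real"
  assumes N: "prob_space N"
    and [measurable]: "\<And>n. Y n \<in> borel_measurable M" "V \<in> borel_measurable N"
    and Y2: "\<And>n. integrable M (\<lambda>\<omega>. (Y n \<omega>)\<^sup>2)"
    and Y4: "\<And>n. integrable M (\<lambda>\<omega>. Y n \<omega> ^ 4)"
    and B: "\<And>n. n \<ge> 1 \<Longrightarrow> (\<integral>\<omega>. Y n \<omega> ^ 4 \<partial>M) \<le> B"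
    and V2: "integrable N (\<lambda>\<omega>. (V \<omega>)\<^sup>2)"
    and conv: "\<And>(g :: real \<Rightarrow> real) b. continuous_on UNIV g \<Longrightarrow> (\<And>z. \<bar>g z\<bar> \<le> b) \<Longrightarrow> (\<lambda>n. \<integral>\<omega>. g (Y n \<omega>) \<partial>M) \<longlonglongrightarrow> (\<integral>\<omega>. g (V \<omega>) \<partial>N)"
  shows "(\<lambda>n. \<integral>\<omega>. (Y n \<omega>)\<^sup>2 \<partial>M) \<longlonglongrightarrow> (\<integral>\<omega>. (V \<omega>)\<^sup>2 \<partial>N)"
proof (rule tendstoI)
  fix e :: real assume e: "e > 0"
  interpret N: prob_space N by fact
  define g where "g k z = min (z\<^sup>2) (real k)" for k :: nat and z :: real
  have gb: "\<bar>g k z\<bar> \<le> real k" for k z by (simp add: g_def)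
  have gc: "continuous_on UNIV (g k)" for k unfolding g_def[abs_def] by (intro continuous_intros)
  have [measurable]: "g k \<in> borel_measurable borel" for k using gc by (rule borel_measurable_continuous_onI)
  have gV: "(\<lambda>k. \<integral>\<omega>. g k (V \<omega>) \<partial>N) \<longlonglongrightarrow> (\<integral>\<omega>. (V \<omega>)\<^sup>2 \<partial>N)"
  proof (rule integral_dominated_convergence[where w = "\<lambda>\<omega>. (V \<omega>)\<^sup>2"])
    show "AE \<omega> in N. (\<lambda>k. g k (V \<omega>)) \<longlonglongrightarrow> (V \<omega>)\<^sup>2"
    proof (rule AE_I2)
      fix \<omega>
      obtain k0 :: nat where "(V \<omega>)\<^sup>2 \<le> real k0" using real_arch_simple by blast
      then have "\<forall>\<^sub>F k in sequentially. g k (V \<omega>) = (V \<omega>)\<^sup>2"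
        by (intro eventually_sequentiallyI[of k0]) (auto simp: g_def)
      then show "(\<lambda>k. g k (V \<omega>)) \<longlonglongrightarrow> (V \<omega>)\<^sup>2" by (rule tendsto_eventually)
    qed
  qed (use V2 in \<open>auto simp: g_def\<close>)
  have "(\<lambda>k. B / real k) \<longlonglongrightarrow> 0" by (rule lim_const_over_n)
  then have "\<forall>\<^sub>F k in sequentially. B / real k < e / 3" using e by (intro order_tendstoD(2)) auto
  moreover have "\<forall>\<^sub>F k in sequentially. dist (\<integral>\<omega>. g k (V \<omega>) \<partial>N) (\<integral>\<omega>. (V \<omega>)\<^sup>2 \<partial>N) < e / 3"
    using e by (intro tendstoD[OF gV]) auto
  \<comment> \<open>The truncation level is chosen once, before \<open>n\<close>, to serve both the
    limit variable and the whole sequence.\<close>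
  ultimately have "\<forall>\<^sub>F k in sequentially. k > 0 \<and> B / real k < e / 3 \<and> dist (\<integral>\<omega>. g k (V \<omega>) \<partial>N) (\<integral>\<omega>. (V \<omega>)\<^sup>2 \<partial>N) < e / 3"
    using eventually_gt_at_top[of "0::nat"] by eventually_elim auto
  then obtain k :: nat where k: "k > 0" "B / real k < e / 3" "dist (\<integral>\<omega>. g k (V \<omega>) \<partial>N) (\<integral>\<omega>. (V \<omega>)\<^sup>2 \<partial>N) < e / 3"
    using eventually_happens'[OF sequentially_bot] by blast
  have cut: "z\<^sup>2 - g k z \<le> z ^ 4 / real k" "g k z \<le> z\<^sup>2" for z
  proof -
    have "z ^ 4 = z\<^sup>2 * z\<^sup>2" by (simp flip: power_add)
    moreover have "real k * z\<^sup>2 \<le> z\<^sup>2 * z\<^sup>2" if "real k \<le> z\<^sup>2" using that by (intro mult_right_mono) auto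
    ultimately have "z\<^sup>2 \<le> z ^ 4 / real k" if "real k \<le> z\<^sup>2" using that k by (simp add: field_simps)
    then show "z\<^sup>2 - g k z \<le> z ^ 4 / real k" by (auto simp: g_def min_def)
  qed (simp add: g_def)
  have gi: "integrable M (\<lambda>\<omega>. g k (Y n \<omega>))" for n
    by (rule integrable_const_bound[of _ "real k"]) (use gb in auto)
  have "\<forall>\<^sub>F n in sequentially. dist (\<integral>\<omega>. g k (Y n \<omega>) \<partial>M) (\<integral>\<omega>. g k (V \<omega>) \<partial>N) < e / 3"
    using e by (intro tendstoD[OF conv[of "g k" "real k"]] gc gb) auto
  then show "\<forall>\<^sub>F n in sequentially. dist (\<integral>\<omega>. (Y n \<omega>)\<^sup>2 \<partial>M) (\<integral>\<omega>. (V \<omega>)\<^sup>2 \<partial>N) < e"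
    using eventually_ge_at_top[of 1]
  proof eventually_elim
    case (elim n)
    have "(\<integral>\<omega>. (Y n \<omega>)\<^sup>2 \<partial>M) - (\<integral>\<omega>. g k (Y n \<omega>) \<partial>M) = (\<integral>\<omega>. (Y n \<omega>)\<^sup>2 - g k (Y n \<omega>) \<partial>M)"
      by (simp add: Y2 gi)
    also have "\<dots> \<le> (\<integral>\<omega>. Y n \<omega> ^ 4 / real k \<partial>M)"
      by (rule integral_mono) (auto intro: Y2 gi Y4 cut)
    also have "\<dots> \<le> B / real k" using B[OF elim(2)] by (simp add: divide_right_mono)
    finally have "(\<integral>\<omega>. (Y n \<omega>)\<^sup>2 \<partial>M) - (\<integral>\<omega>. g k (Y n \<omega>) \<partial>M) < e / 3" using k(2) by linarith
    moreover have "(\<integral>\<omega>. g k (Y n \<omega>) \<partial>M) \<le> (\<integral>\<omega>. (Y n \<omega>)\<^sup>2 \<partial>M)"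
      by (rule integral_mono) (auto intro: Y2 gi cut)
    ultimately show ?case using k(3) elim(1) unfolding dist_real_def by linarith
  qed
qed

text \<open>\<open>cts_step x y\<close> falls linearly from 1 at \<open>x\<close> to 0 at
  \<open>y\<close>. These functions suffice to test weak convergence on the line, and being monotone
  and Lipschitz they suit the arguments below.\<close>

lemma continuous_on_cts_step: "x < y \<Longrightarrow> continuous_on UNIV (cts_step x y)"
  by (rule uniformly_continuous_imp_continuous[OF cts_step_uniformly_continuous])

lemma cts_step_range: "x < y \<Longrightarrow> 0 \<le> cts_step x y z \<and> cts_step x y z \<le> 1"
  by (auto simp: cts_step_def)

lemma cts_step_antimono: "x < y \<Longrightarrow> a \<le> b \<Longrightarrow> cts_step x y b \<le> cts_step x y a"
  by (auto simp: cts_step_def divide_right_mono)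

lemma cts_step_diff_le:
  assumes "x < y"
  shows "\<bar>cts_step x y a - cts_step x y b\<bar> \<le> \<bar>a - b\<bar> / (y - x)"
proof -
  \<comment> \<open>Clipping to the unit interval does not increase distances.\<close>
  have eq: "cts_step x y z = max 0 (min 1 ((y - z) / (y - x)))" for z
    using assms by (auto simp: cts_step_def max_def min_def field_simps)
  have "\<bar>cts_step x y a - cts_step x y b\<bar> \<le> \<bar>(y - a) / (y - x) - (y - b) / (y - x)\<bar>"
    unfolding eq by linarith
  also have "\<dots> = \<bar>a - b\<bar> / (y - x)"
    using assms by (simp add: abs_minus_commute flip: diff_divide_distrib)
  finally show ?thesis .
qed

lemma borel_measurable_cts_step [measurable]: "cts_step x y \<in> borel_measurable borel"
  unfolding cts_step_def[abs_def] by measurable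

text \<open>Slutsky's theorem for products of nonnegative variables. As the test functions are decreasing,
  the product can be sandwiched between two constant multiples, so no tightness is needed.\<close>

lemma (in prob_space) weak_conv_mult_nonneg:
  fixes A Q :: "nat \<Rightarrow> 'a \<Rightarrow> real" and V :: "'b \<Rightarrow> real"
  assumes N: "prob_space N"
    and [measurable]: "\<And>n. A n \<in> borel_measurable M" "\<And>n. Q n \<in> borel_measurable M" "V \<in> borel_measurable N"
    and A0: "\<And>n \<omega>. \<omega> \<in> space M \<Longrightarrow> 0 \<le> A n \<omega>"
    and r: "r > 0"
    and conv: "\<And>x y s. x < y \<Longrightarrow> s > 0 \<Longrightarrow>
      (\<lambda>n. \<integral>\<omega>. cts_step x y (s * A n \<omega>) \<partial>M) \<longlonglongrightarrow> (\<integral>\<omega>. cts_step x y (s * V \<omega>) \<partial>N)"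
    and Q: "\<And>e. e > 0 \<Longrightarrow> (\<lambda>n. prob {\<omega> \<in> space M. \<bar>Q n \<omega> - r\<bar> \<ge> e}) \<longlonglongrightarrow> 0"
  shows "weak_conv_m (\<lambda>n. distr M borel (\<lambda>\<omega>. A n \<omega> * Q n \<omega>)) (distr N borel (\<lambda>\<omega>. r * V \<omega>))"
proof (rule integral_cts_step_conv_imp_weak_conv)
  interpret N: prob_space N by fact
  show "real_distribution (distr M borel (\<lambda>\<omega>. A n \<omega> * Q n \<omega>))" for n
    by (rule real_distribution_distr) measurable
  show "real_distribution (distr N borel (\<lambda>\<omega>. r * V \<omega>))"
    by (rule N.real_distribution_distr) measurable
  fix x y :: real assume xy: "x < y"
  let ?\<phi> = "cts_step x y"
  \<comment> \<open>The limit as a function of the scale. Dominated convergence makes it continuous,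
    which closes the gap between the scales \<open>r - e\<close> and \<open>r + e\<close>.\<close>
  define f where "f s = (\<integral>\<omega>. ?\<phi> (s * V \<omega>) \<partial>N)" for s
  have isCont_phi: "isCont ?\<phi> z" for z
    using continuous_on_cts_step[OF xy] by (simp add: continuous_on_eq_continuous_at)
  have "isCont f r"
    unfolding continuous_at_sequentially
  proof (intro allI impI)
    fix u assume u: "u \<longlonglongrightarrow> r"
    show "(f \<circ> u) \<longlonglongrightarrow> f r"
      unfolding f_def comp_def
    proof (rule integral_dominated_convergence[where w = "\<lambda>_. 1"])
      show "AE \<omega> in N. (\<lambda>n. ?\<phi> (u n * V \<omega>)) \<longlonglongrightarrow> ?\<phi> (r * V \<omega>)"
        by (intro AE_I2 isCont_tendsto_compose[OF isCont_phi] tendsto_intros u)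
    qed (use cts_step_range[OF xy] in auto)
  qed
  then have fr: "(f \<longlongrightarrow> f r) (at r)" by (simp add: isCont_def)
  have integ: "integrable M (\<lambda>\<omega>. ?\<phi> (s * A n \<omega>))" for s n
    by (rule integrable_const_bound[of _ 1]) (use cts_step_range[OF xy] in auto)
  have integQ: "integrable M (\<lambda>\<omega>. ?\<phi> (A n \<omega> * Q n \<omega>))" for n
    by (rule integrable_const_bound[of _ 1]) (use cts_step_range[OF xy] in auto)
  have "(\<lambda>n. \<integral>\<omega>. ?\<phi> (A n \<omega> * Q n \<omega>) \<partial>M) \<longlonglongrightarrow> f r"
  proof (rule tendstoI)
    fix \<epsilon> :: real assume eps: "\<epsilon> > 0"
    then have "\<exists>d>0. \<forall>s. s \<noteq> r \<and> dist s r < d \<longrightarrow> dist (f s) (f r) < \<epsilon> / 3"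
      using tendstoD[OF fr, of "\<epsilon> / 3"] unfolding eventually_at by auto
    then obtain d where d: "d > 0" "\<And>s. s \<noteq> r \<Longrightarrow> dist s r < d \<Longrightarrow> dist (f s) (f r) < \<epsilon> / 3" by blast
    \<comment> \<open>Halving the minimum keeps \<open>r - e\<close> positive, where
      \<open>conv\<close> applies, and both scales within the continuity radius
      \<open>d\<close>.\<close>
    define e where "e = min d r / 2"
    have e: "0 < e" "e < d" "e < r" using d r by (auto simp: e_def)
    have f1: "\<bar>f (r - e) - f r\<bar> < \<epsilon> / 3" and f2: "\<bar>f (r + e) - f r\<bar> < \<epsilon> / 3"
      using d(2)[of "r - e"] d(2)[of "r + e"] e by (auto simp: dist_real_def)
    let ?bad = "\<lambda>n. {\<omega> \<in> space M. \<bar>Q n \<omega> - r\<bar> \<ge> e}"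
    have [measurable]: "?bad n \<in> sets M" for n by measurable
    have c1: "(\<lambda>n. \<integral>\<omega>. ?\<phi> ((r - e) * A n \<omega>) \<partial>M) \<longlonglongrightarrow> f (r - e)"
      and c2: "(\<lambda>n. \<integral>\<omega>. ?\<phi> ((r + e) * A n \<omega>) \<partial>M) \<longlonglongrightarrow> f (r + e)"
      unfolding f_def using e r by (auto intro!: conv xy)
    have "\<forall>\<^sub>F n in sequentially. dist (\<integral>\<omega>. ?\<phi> ((r - e) * A n \<omega>) \<partial>M) (f (r - e)) < \<epsilon> / 3"
      "\<forall>\<^sub>F n in sequentially. dist (\<integral>\<omega>. ?\<phi> ((r + e) * A n \<omega>) \<partial>M) (f (r + e)) < \<epsilon> / 3"
      "\<forall>\<^sub>F n in sequentially. dist (prob (?bad n)) 0 < \<epsilon> / 3"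
      using tendstoD[OF c1, of "\<epsilon> / 3"] tendstoD[OF c2, of "\<epsilon> / 3"] tendstoD[OF Q[OF e(1)], of "\<epsilon> / 3"] eps
      by simp_all
    then show "\<forall>\<^sub>F n in sequentially. dist (\<integral>\<omega>. ?\<phi> (A n \<omega> * Q n \<omega>) \<partial>M) (f r) < \<epsilon>"
    proof eventually_elim
      case (elim n)
      have ind: "integrable M (\<lambda>\<omega>. indicator (?bad n) \<omega> :: real)"
        by (rule integrable_const_bound[of _ 1]) auto
      have indI: "(\<integral>\<omega>. indicator (?bad n) \<omega> \<partial>M) = prob (?bad n)" by simp
      \<comment> \<open>Off the bad event, \<open>A n \<ge> 0\<close> and the decrease of the test
        function give the bounds in reversed order; on it, values in the unit interval let the
        indicator absorb everything.\<close>
      have sandwich: "?\<phi> (A n \<omega> * Q n \<omega>) \<le> ?\<phi> ((r - e) * A n \<omega>) + indicator (?bad n) \<omega>"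
        "?\<phi> ((r + e) * A n \<omega>) - indicator (?bad n) \<omega> \<le> ?\<phi> (A n \<omega> * Q n \<omega>)" if w: "\<omega> \<in> space M" for \<omega>
      proof -
        have *: "?\<phi> (A n \<omega> * Q n \<omega>) \<le> ?\<phi> ((r - e) * A n \<omega>) \<and> ?\<phi> ((r + e) * A n \<omega>) \<le> ?\<phi> (A n \<omega> * Q n \<omega>)"
          if "\<bar>Q n \<omega> - r\<bar> < e"
        proof (intro conjI cts_step_antimono xy)
          show "(r - e) * A n \<omega> \<le> A n \<omega> * Q n \<omega>"
            unfolding mult.commute[of "r - e"] using that A0[OF w] by (intro mult_left_mono) auto
          show "A n \<omega> * Q n \<omega> \<le> (r + e) * A n \<omega>"
            unfolding mult.commute[of "r + e"] using that A0[OF w] by (intro mult_left_mono) auto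
        qed
        show "?\<phi> (A n \<omega> * Q n \<omega>) \<le> ?\<phi> ((r - e) * A n \<omega>) + indicator (?bad n) \<omega>"
          "?\<phi> ((r + e) * A n \<omega>) - indicator (?bad n) \<omega> \<le> ?\<phi> (A n \<omega> * Q n \<omega>)"
          using * w cts_step_range[OF xy, of "A n \<omega> * Q n \<omega>"] cts_step_range[OF xy, of "(r - e) * A n \<omega>"]
            cts_step_range[OF xy, of "(r + e) * A n \<omega>"]
          by (auto simp: indicator_def not_le)
      qed
      have "(\<integral>\<omega>. ?\<phi> (A n \<omega> * Q n \<omega>) \<partial>M) \<le> (\<integral>\<omega>. ?\<phi> ((r - e) * A n \<omega>) + indicator (?bad n) \<omega> \<partial>M)"
        by (rule integral_mono[OF integQ Bochner_Integration.integrable_add[OF integ ind] sandwich(1)])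
      also have "\<dots> = (\<integral>\<omega>. ?\<phi> ((r - e) * A n \<omega>) \<partial>M) + prob (?bad n)"
        by (simp only: Bochner_Integration.integral_add[OF integ ind] indI)
      finally have up: "(\<integral>\<omega>. ?\<phi> (A n \<omega> * Q n \<omega>) \<partial>M) \<le> (\<integral>\<omega>. ?\<phi> ((r - e) * A n \<omega>) \<partial>M) + prob (?bad n)" .
      have "(\<integral>\<omega>. ?\<phi> ((r + e) * A n \<omega>) \<partial>M) - prob (?bad n) = (\<integral>\<omega>. ?\<phi> ((r + e) * A n \<omega>) - indicator (?bad n) \<omega> \<partial>M)"
        by (simp only: Bochner_Integration.integral_diff[OF integ ind] indI)
      also have "\<dots> \<le> (\<integral>\<omega>. ?\<phi> (A n \<omega> * Q n \<omega>) \<partial>M)"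
        by (rule integral_mono[OF Bochner_Integration.integrable_diff[OF integ ind] integQ sandwich(2)])
      finally have lo: "(\<integral>\<omega>. ?\<phi> ((r + e) * A n \<omega>) \<partial>M) - prob (?bad n) \<le> (\<integral>\<omega>. ?\<phi> (A n \<omega> * Q n \<omega>) \<partial>M)" .
      show ?case using up lo elim f1 f2 unfolding dist_real_def by linarith
    qed
  qed
  then show "(\<lambda>n. integral\<^sup>L (distr M borel (\<lambda>\<omega>. A n \<omega> * Q n \<omega>)) ?\<phi>) \<longlonglongrightarrow> integral\<^sup>L (distr N borel (\<lambda>\<omega>. r * V \<omega>)) ?\<phi>"
    by (simp add: integral_distr f_def)
qed

text \<open>Closeness in mean is enough since the test function has Lipschitz constant
  \<open>1 / (y - x)\<close>. It carries the limit over from the bridge supremum to the discrete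
  maximum.\<close>

lemma (in prob_space) cts_step_tendsto_close:
  fixes A B E :: "nat \<Rightarrow> 'a \<Rightarrow> real"
  assumes [measurable]: "\<And>n. A n \<in> borel_measurable M" "\<And>n. B n \<in> borel_measurable M"
    and E: "\<And>n. integrable M (E n)" "(\<lambda>n. \<integral>\<omega>. E n \<omega> \<partial>M) \<longlonglongrightarrow> 0"
    and AB: "\<And>n \<omega>. n \<ge> 1 \<Longrightarrow> \<omega> \<in> space M \<Longrightarrow> \<bar>A n \<omega> - B n \<omega>\<bar> \<le> E n \<omega>"
    and xy: "x < y" and s: "s > 0"
    and conv: "(\<lambda>n. \<integral>\<omega>. cts_step x y (s * B n \<omega>) \<partial>M) \<longlonglongrightarrow> l"
  shows "(\<lambda>n. \<integral>\<omega>. cts_step x y (s * A n \<omega>) \<partial>M) \<longlonglongrightarrow> l"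
proof (rule Lim_transform[OF conv])
  have int: "integrable M (\<lambda>\<omega>. cts_step x y (s * F n \<omega>))" if [measurable]: "\<And>n. F n \<in> borel_measurable M" for F n
    by (rule integrable_const_bound[of _ 1]) (use cts_step_range[OF xy] in auto)
  have b: "norm ((\<integral>\<omega>. cts_step x y (s * A n \<omega>) \<partial>M) - (\<integral>\<omega>. cts_step x y (s * B n \<omega>) \<partial>M)) \<le> s / (y - x) * (\<integral>\<omega>. E n \<omega> \<partial>M)"
    if n: "n \<ge> 1" for n
  proof -
    have "(\<integral>\<omega>. cts_step x y (s * A n \<omega>) \<partial>M) - (\<integral>\<omega>. cts_step x y (s * B n \<omega>) \<partial>M)
        = (\<integral>\<omega>. cts_step x y (s * A n \<omega>) - cts_step x y (s * B n \<omega>) \<partial>M)"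
      by (simp add: int)
    also have "norm \<dots> \<le> (\<integral>\<omega>. \<bar>cts_step x y (s * A n \<omega>) - cts_step x y (s * B n \<omega>)\<bar> \<partial>M)"
      using integral_norm_bound[of M "\<lambda>\<omega>. cts_step x y (s * A n \<omega>) - cts_step x y (s * B n \<omega>)"] by simp
    also have "\<dots> \<le> (\<integral>\<omega>. s / (y - x) * E n \<omega> \<partial>M)"
    proof (rule integral_mono)
      fix \<omega> assume w: "\<omega> \<in> space M"
      have "\<bar>cts_step x y (s * A n \<omega>) - cts_step x y (s * B n \<omega>)\<bar> \<le> \<bar>s * A n \<omega> - s * B n \<omega>\<bar> / (y - x)"
        by (rule cts_step_diff_le[OF xy])
      also have "\<bar>s * A n \<omega> - s * B n \<omega>\<bar> = s * \<bar>A n \<omega> - B n \<omega>\<bar>"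
        using s by (simp add: abs_mult flip: right_diff_distrib)
      also have "s * \<bar>A n \<omega> - B n \<omega>\<bar> / (y - x) \<le> s * E n \<omega> / (y - x)"
        using AB[OF n w] s xy by (intro divide_right_mono mult_left_mono) auto
      finally show "\<bar>cts_step x y (s * A n \<omega>) - cts_step x y (s * B n \<omega>)\<bar> \<le> s / (y - x) * E n \<omega>" by simp
    qed (auto intro!: int E integrable_abs Bochner_Integration.integrable_diff)
    finally show ?thesis by simp
  qed
  show "(\<lambda>n. (\<integral>\<omega>. cts_step x y (s * A n \<omega>) \<partial>M) - (\<integral>\<omega>. cts_step x y (s * B n \<omega>) \<partial>M)) \<longlonglongrightarrow> 0"
  proof (rule Lim_null_comparison)
    show "\<forall>\<^sub>F n in sequentially. norm ((\<integral>\<omega>. cts_step x y (s * A n \<omega>) \<partial>M) - (\<integral>\<omega>. cts_step x y (s * B n \<omega>) \<partial>M)) \<le> s / (y - x) * (\<integral>\<omega>. E n \<omega> \<partial>M)"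
      using b by (rule eventually_sequentiallyI)
    show "(\<lambda>n. s / (y - x) * (\<integral>\<omega>. E n \<omega> \<partial>M)) \<longlonglongrightarrow> 0" using tendsto_mult_right_zero[OF E(2)] .
  qed
qed

section \<open>Covariances and cumulants of a fourth-order stationary sequence\<close>

lemma (in prob_space) integrable_prod_list4:
  fixes fs :: "('a \<Rightarrow> real) list"
  assumes len: "length fs \<le> 4"
    and meas: "\<And>f. f \<in> set fs \<Longrightarrow> f \<in> borel_measurable M"
    and int: "\<And>f. f \<in> set fs \<Longrightarrow> integrable M (\<lambda>\<omega>. f \<omega> ^ 4)"
  shows "integrable M (\<lambda>\<omega>. prod_list (map (\<lambda>f. f \<omega>) fs))"
proof -
  \<comment> \<open>Padding with the constant 1 brings every product to exactly four
    factors.\<close>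
  define h where "h i = (if i < length fs then fs ! i else (\<lambda>_. 1))" for i
  have h: "h i \<in> borel_measurable M" "integrable M (\<lambda>\<omega>. h i \<omega> ^ 4)" for i
    using meas int by (auto simp: h_def)
  have "prod_list (map (\<lambda>f. f \<omega>) fs) = h 0 \<omega> * h 1 \<omega> * h 2 \<omega> * h 3 \<omega>" for \<omega>
  proof -
    have "length fs = 0 \<or> length fs = 1 \<or> length fs = 2 \<or> length fs = 3 \<or> length fs = 4" using len by linarith
    then show ?thesis
      by (auto simp: h_def length_Suc_conv numeral_eq_Suc mult.assoc)
  qed
  then show ?thesis using integrable_mult4[of "h 0" "h 1" "h 2" "h 3"] h by simp
qed

lemma power4_diff_le: "(a - b) ^ 4 \<le> 8 * a ^ 4 + 8 * (b::real) ^ 4"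
proof -
  have sq: "(x - y)\<^sup>2 \<le> 2 * x\<^sup>2 + 2 * y\<^sup>2" for x y :: real
    using sum_squares_bound[of x "- y"] by (simp add: power2_diff)
  have p4: "x ^ 4 = (x\<^sup>2)\<^sup>2" for x :: real by (simp flip: power_mult)
  have "(a - b) ^ 4 \<le> (2 * a\<^sup>2 + 2 * b\<^sup>2)\<^sup>2"
    unfolding p4 by (intro power_mono sq) auto
  also have "\<dots> \<le> 2 * (2 * a\<^sup>2)\<^sup>2 + 2 * (2 * b\<^sup>2)\<^sup>2"
    using sq[of "2 * a\<^sup>2" "- (2 * b\<^sup>2)"] by simp
  finally show ?thesis by (simp add: power_mult_distrib flip: power_mult)
qed

lemma centered_power4_integrable:
  assumes "prob_space M" "fourth_order_stationary M X"
  shows "integrable M (\<lambda>\<omega>. (X i \<omega> - \<mu>) ^ 4)"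
proof (rule Bochner_Integration.integrable_bound)
  interpret prob_space M by fact
  have [measurable]: "X i \<in> borel_measurable M" and int: "integrable M (\<lambda>\<omega>. X i \<omega> ^ 4)"
    using assms(2) by (auto simp: fourth_order_stationary_def)
  show "integrable M (\<lambda>\<omega>. 8 * X i \<omega> ^ 4 + 8 * \<mu> ^ 4)" using int by simp
  show "(\<lambda>\<omega>. (X i \<omega> - \<mu>) ^ 4) \<in> borel_measurable M" by measurable
  show "AE \<omega> in M. norm ((X i \<omega> - \<mu>) ^ 4) \<le> norm (8 * X i \<omega> ^ 4 + 8 * \<mu> ^ 4)"
    using order.trans[OF power4_diff_le abs_ge_self] by (intro AE_I2) simp
qed

text \<open>Stationarity speaks of raw moments. Writing the first centred factor as
  \<open>X x - \<mu>\<close> either moves \<open>x\<close> to the raw list or drops it, so the total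
  length stays at most four; \<open>ys\<close> must be general for this induction.\<close>

lemma centered_moment_shift:
  fixes X :: "int \<Rightarrow> 'a \<Rightarrow> real"
  assumes M: "prob_space M" and X: "fourth_order_stationary M X"
  shows "length xs + length ys \<le> 4 \<Longrightarrow>
    (\<integral>\<omega>. prod_list (map (\<lambda>i. X (i + k) \<omega> - \<mu>) xs) * prod_list (map (\<lambda>i. X (i + k) \<omega>) ys) \<partial>M)
    = (\<integral>\<omega>. prod_list (map (\<lambda>i. X i \<omega> - \<mu>) xs) * prod_list (map (\<lambda>i. X i \<omega>) ys) \<partial>M)"
proof (induction xs arbitrary: ys)
  case Nil
  then show ?case using X by (simp add: fourth_order_stationary_def)
next
  case (Cons x xs)
  interpret prob_space M by fact
  have int: "integrable M (\<lambda>\<omega>. prod_list (map (\<lambda>i. X (i + k) \<omega> - \<mu>) us) * prod_list (map (\<lambda>i. X (i + k) \<omega>) vs))"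
    if "length us + length vs \<le> 4" for us vs :: "int list" and k
  proof -
    have "integrable M (\<lambda>\<omega>. prod_list (map (\<lambda>f. f \<omega>) (map (\<lambda>i \<omega>. X (i + k) \<omega> - \<mu>) us @ map (\<lambda>i. X (i + k)) vs)))"
    proof (rule integrable_prod_list4)
      fix f assume "f \<in> set (map (\<lambda>i \<omega>. X (i + k) \<omega> - \<mu>) us @ map (\<lambda>i. X (i + k)) vs)"
      then show "f \<in> borel_measurable M" "integrable M (\<lambda>\<omega>. f \<omega> ^ 4)"
        using X centered_power4_integrable[OF M X]
        by (auto simp: fourth_order_stationary_def intro!: borel_measurable_diff)
    qed (use that in simp)
    then show ?thesis by (simp add: comp_def)
  qed
  have split: "(\<integral>\<omega>. prod_list (map (\<lambda>i. X (i + k) \<omega> - \<mu>) (x # xs)) * prod_list (map (\<lambda>i. X (i + k) \<omega>) ys) \<partial>M)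
     = (\<integral>\<omega>. prod_list (map (\<lambda>i. X (i + k) \<omega> - \<mu>) xs) * prod_list (map (\<lambda>i. X (i + k) \<omega>) (x # ys)) \<partial>M)
      - \<mu> * (\<integral>\<omega>. prod_list (map (\<lambda>i. X (i + k) \<omega> - \<mu>) xs) * prod_list (map (\<lambda>i. X (i + k) \<omega>) ys) \<partial>M)" for k
  proof -
    have i: "integrable M (\<lambda>\<omega>. prod_list (map (\<lambda>i. X (i + k) \<omega> - \<mu>) xs) * prod_list (map (\<lambda>i. X (i + k) \<omega>) (x # ys)))"
        "integrable M (\<lambda>\<omega>. prod_list (map (\<lambda>i. X (i + k) \<omega> - \<mu>) xs) * prod_list (map (\<lambda>i. X (i + k) \<omega>) ys))"
      using Cons.prems by (auto intro!: int simp del: list.map)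
    show ?thesis
      unfolding integral_mult_right_zero[symmetric]
      by (subst Bochner_Integration.integral_diff[symmetric, OF i(1) integrable_mult_right[OF i(2)]])
        (simp add: algebra_simps)
  qed
  show ?case
    using split[of k] split[of 0] Cons.IH[of "x # ys"] Cons.IH[of ys] Cons.prems by simp
qed

lemma fourth_order_seq_centered:
  fixes X :: "int \<Rightarrow> 'a \<Rightarrow> real"
  assumes M: "prob_space M" and X: "fourth_order_stationary M X"
  shows "fourth_order_seq M (\<lambda>i \<omega>. X i \<omega> - seq_mean M X) (autocov M X) (cum4 M X)"
proof -
  interpret prob_space M by fact
  let ?\<mu> = "seq_mean M X" and ?\<gamma> = "autocov M X"
  have cov: "(\<integral>\<omega>. (X i \<omega> - ?\<mu>) * (X j \<omega> - ?\<mu>) \<partial>M) = ?\<gamma> (j - i)" for i j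
    using centered_moment_shift[OF M X, of "[0, j - i]" "[]" i ?\<mu>] by (simp add: autocov_def)
  \<comment> \<open>Evenness reconciles the lag signs in \<open>cum4\<close> with those in the
    locale assumption.\<close>
  have sym: "?\<gamma> (j - i) = ?\<gamma> (i - j)" for i j
    using cov[of i j] cov[of j i] by (simp add: mult.commute)
  show ?thesis
  proof
    show "(\<lambda>\<omega>. X i \<omega> - ?\<mu>) \<in> borel_measurable M" for i
      using X by (intro borel_measurable_diff) (auto simp: fourth_order_stationary_def)
    show "integrable M (\<lambda>\<omega>. (X i \<omega> - ?\<mu>) ^ 4)" for i by (rule centered_power4_integrable[OF M X])
    show "(\<integral>\<omega>. (X i \<omega> - ?\<mu>) * (X j \<omega> - ?\<mu>) \<partial>M) = ?\<gamma> (j - i)" for i j by (rule cov)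
    show "(\<integral>\<omega>. (X i \<omega> - ?\<mu>) * (X j \<omega> - ?\<mu>) * (X k \<omega> - ?\<mu>) * (X l \<omega> - ?\<mu>) \<partial>M) =
      cum4 M X (j - i) (k - i) (l - i) + ?\<gamma> (j - i) * ?\<gamma> (l - k) + ?\<gamma> (k - i) * ?\<gamma> (l - j) + ?\<gamma> (l - i) * ?\<gamma> (k - j)" for i j k l
      using centered_moment_shift[OF M X, of "[0, j - i, k - i, l - i]" "[]" i ?\<mu>]
      by (simp add: cum4_def mult.assoc sym[of k l] sym[of j l] sym[of j k])
  qed
qed

text \<open>Comparison with the integral of the decreasing function \<open>z powr (a - 1)\<close>,
  one unit step at a time by the mean value theorem.\<close>

lemma sum_powr_le:
  fixes a :: real
  assumes a: "0 < a" "a \<le> 1"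
  shows "(\<Sum>j=1..n. real j powr (a - 1)) \<le> real n powr a / a"
proof (induction n)
  case (Suc n)
  have step: "a * real (Suc n) powr (a - 1) \<le> real (Suc n) powr a - real n powr a"
  proof (cases "n = 0")
    \<comment> \<open>At 0 the power is not differentiable; the step reads \<open>a \<le> 1\<close>
      because \<open>0 powr a = 0\<close>.\<close>
    case True then show ?thesis using a by simp
  next
    case False
    have "\<exists>z. real n < z \<and> z < real (Suc n) \<and>
      real (Suc n) powr a - real n powr a = (real (Suc n) - real n) * (a * z powr (a - 1))"
      using False by (intro MVT2) (auto intro!: has_real_derivative_powr)
    then obtain z where z: "real n < z" "z < real (Suc n)"
      "real (Suc n) powr a - real n powr a = (real (Suc n) - real n) * (a * z powr (a - 1))" by blast
    have "real (Suc n) powr (a - 1) \<le> z powr (a - 1)"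
      using z False a by (intro powr_mono2') auto
    then show ?thesis using z(3) a by simp
  qed
  then have "real (Suc n) powr (a - 1) \<le> (real (Suc n) powr a - real n powr a) / a"
    using a by (simp add: field_simps)
  then show ?case using Suc.IH by (simp add: diff_divide_distrib)
qed simp

lemma sum_int_symmetric:
  fixes f :: "int \<Rightarrow> real"
  assumes "\<And>k. f (- k) = f k"
  shows "(\<Sum>k\<in>{- int n..int n}. f k) = f 0 + 2 * (\<Sum>j=1..n. f (int j))"
proof -
  have "{- int n..int n} = {- int n..-1} \<union> {0} \<union> {1..int n}" by auto
  then have "(\<Sum>k\<in>{- int n..int n}. f k) = (\<Sum>k\<in>{- int n..-1}. f k) + f 0 + (\<Sum>k\<in>{1..int n}. f k)"
    by (simp add: sum.union_disjoint)
  also have "(\<Sum>k\<in>{- int n..-1}. f k) = (\<Sum>k\<in>{1..int n}. f k)"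
    by (rule sum.reindex_bij_witness[of _ uminus uminus]) (auto simp: assms)
  finally show ?thesis by (simp add: sum_int_atLeastAtMost)
qed

lemma (in fourth_order_seq) G_bound:
  assumes H: "1/2 < H" "H < 1" and c0: "c0 > 0"
    and lim: "(\<lambda>j::nat. \<gamma> (int j) / (c0 * real j powr (2*H - 2))) \<longlonglongrightarrow> 1"
  shows "\<exists>C\<ge>0. \<forall>n\<ge>1. G n \<le> C * real n powr (2 * H - 1)"
proof -
  have sym: "\<gamma> (- k) = \<gamma> k" for k
    using cov[of 0 k] cov[of k 0] by (simp add: mult.commute)
  \<comment> \<open>A convergent ratio is bounded over all \<open>j\<close>, so no initial segment
    needs separate treatment.\<close>
  obtain B where B: "B > 0" "\<And>j. norm (\<gamma> (int j) / (c0 * real j powr (2*H - 2))) \<le> B"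
    using convergent_imp_Bseq[OF convergentI[OF lim]] by (auto elim: BseqE)
  have gb: "\<bar>\<gamma> (int j)\<bar> \<le> B * c0 * real j powr ((2 * H - 1) - 1)" if "j \<ge> 1" for j
    using B(2)[of j] that c0 by (simp add: abs_mult pos_divide_le_eq mult_ac)
  have "G n \<le> (\<bar>\<gamma> 0\<bar> + 2 * (B * c0 / (2 * H - 1))) * real n powr (2 * H - 1)" if n: "n \<ge> 1" for n
  proof -
    have "G n = \<bar>\<gamma> 0\<bar> + 2 * (\<Sum>j=1..n. \<bar>\<gamma> (int j)\<bar>)"
      unfolding G_def by (rule sum_int_symmetric) (simp add: sym)
    also have "(\<Sum>j=1..n. \<bar>\<gamma> (int j)\<bar>) \<le> (\<Sum>j=1..n. B * c0 * real j powr ((2 * H - 1) - 1))"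
      by (intro sum_mono gb) auto
    also have "\<dots> = B * c0 * (\<Sum>j=1..n. real j powr ((2 * H - 1) - 1))" by (simp only: sum_distrib_left)
    also have "\<dots> \<le> B * c0 * (real n powr (2 * H - 1) / (2 * H - 1))"
      using H B c0 by (intro mult_left_mono sum_powr_le) auto
    also have "\<bar>\<gamma> 0\<bar> \<le> \<bar>\<gamma> 0\<bar> * real n powr (2 * H - 1)"
      using ge_one_powr_ge_zero[of "real n" "2 * H - 1"] n H by (simp add: mult_le_cancel_left1)
    finally show ?thesis by (simp add: algebra_simps)
  qed
  moreover have "0 \<le> \<bar>\<gamma> 0\<bar> + 2 * (B * c0 / (2 * H - 1))" using B c0 H by simp
  ultimately show ?thesis by blast
qed

text \<open>The sums grow with \<open>n\<close>, so below \<open>n0\<close> they are controlled by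
  their value at \<open>n0\<close>, uniformly in \<open>h\<close>. \<open>\<bar>C\<bar>\<close>
  replaces \<open>C\<close>, whose sign is not given.\<close>

lemma cumulant_sum_bound:
  fixes \<kappa> :: "int \<Rightarrow> int \<Rightarrow> int \<Rightarrow> real"
  assumes H: "1/2 < H"
    and ex: "\<exists>C. \<exists>n0. \<forall>n\<ge>n0. \<forall>h::int.
           (\<Sum>r\<in>{-int n..int n}. \<Sum>s\<in>{-int n..int n}. \<bar>\<kappa> h r s\<bar>) \<le> C * real n powr (2*H - 1)"
  shows "\<exists>C\<ge>0. \<forall>n\<ge>1. \<forall>h. (\<Sum>r\<in>{-int n..int n}. \<Sum>s\<in>{-int n..int n}. \<bar>\<kappa> h r s\<bar>) \<le> C * real n powr (2*H - 1)"
proof -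
  let ?S = "\<lambda>n h. \<Sum>r\<in>{-int n..int n}. \<Sum>s\<in>{-int n..int n}. \<bar>\<kappa> h r s\<bar>"
  obtain C n0 where C: "\<And>n h. n \<ge> n0 \<Longrightarrow> ?S n h \<le> C * real n powr (2*H - 1)" using ex by blast
  define C' where "C' = \<bar>C\<bar> + \<bar>C\<bar> * real n0 powr (2*H - 1)"
  have "?S n h \<le> C' * real n powr (2*H - 1)" if n: "n \<ge> 1" for n h
  proof (cases "n \<ge> n0")
    case True
    have "C * real n powr (2*H - 1) \<le> C' * real n powr (2*H - 1)"
      by (intro mult_right_mono) (auto simp: C'_def intro: order.trans[OF abs_ge_self])
    then show ?thesis using C[OF True, of h] by linarith
  next
    case False
    have "?S n h \<le> ?S n0 h"
    proof -
      have "?S n h \<le> (\<Sum>r\<in>{-int n..int n}. \<Sum>s\<in>{-int n0..int n0}. \<bar>\<kappa> h r s\<bar>)"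
        using False by (intro sum_mono sum_mono2) auto
      also have "\<dots> \<le> ?S n0 h" using False by (intro sum_mono2) (auto intro: sum_nonneg)
      finally show ?thesis .
    qed
    also have "\<dots> \<le> C * real n0 powr (2*H - 1)" by (rule C) simp
    also have "\<dots> \<le> \<bar>C\<bar> * real n0 powr (2*H - 1)" by (intro mult_right_mono) auto
    also have "\<dots> \<le> C'" by (simp add: C'_def)
    also have "\<dots> = C' * 1" by simp
    also have "\<dots> \<le> C' * real n powr (2*H - 1)"
      using n H by (intro mult_left_mono ge_one_powr_ge_zero) (auto simp: C'_def)
    finally show ?thesis .
  qed
  moreover have "C' \<ge> 0" by (simp add: C'_def)
  ultimately show ?thesis by blast
qed

text \<open>Measurability comes from the Gaussian law of a one-point linear combination; both
  branches of \<open>gaussian_rv\<close> provide it.\<close>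

lemma fbm_measurable:
  assumes "is_fbm H N W" "t \<in> {0..1}"
  shows "(\<lambda>\<omega>. W \<omega> t) \<in> borel_measurable N"
proof -
  have all: "\<forall>F a. finite F \<and> F \<subseteq> {0..1} \<longrightarrow>
      gaussian_rv N (\<lambda>\<omega>. \<Sum>t\<in>F. a t * W \<omega> t) 0 (\<Sum>s\<in>F. \<Sum>t\<in>F. a s * a t * fbm_cov H s t)"
    using assms(1) by (simp add: is_fbm_def)
  have "gaussian_rv N (\<lambda>\<omega>. \<Sum>s\<in>{t}. 1 * W \<omega> s) 0 (\<Sum>s\<in>{t}. \<Sum>u\<in>{t}. 1 * 1 * fbm_cov H s u)"
    using all[rule_format, of "{t}" "\<lambda>_. 1"] assms(2) by simp
  then show ?thesis
    by (auto simp: gaussian_rv_def dest: distributed_measurable)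
qed

lemma fbm_1_second_moment:
  assumes W: "is_fbm H N W"
  shows "integrable N (\<lambda>\<omega>. (W \<omega> 1)\<^sup>2)" "(\<integral>\<omega>. (W \<omega> 1)\<^sup>2 \<partial>N) = 1"
proof -
  have all: "\<forall>F a. finite F \<and> F \<subseteq> {0..1} \<longrightarrow>
      gaussian_rv N (\<lambda>\<omega>. \<Sum>t\<in>F. a t * W \<omega> t) 0 (\<Sum>s\<in>F. \<Sum>t\<in>F. a s * a t * fbm_cov H s t)"
    using assms(1) by (simp add: is_fbm_def)
  \<comment> \<open>\<open>fbm_cov H 1 1\<close> is 1 because \<open>0 powr (2 * H) = 0\<close>, so
    the nondegenerate branch applies with unit variance.\<close>
  have d: "distributed N lborel (\<lambda>\<omega>. W \<omega> 1) (normal_density 0 1)"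
    using all[rule_format, of "{1}" "\<lambda>_. 1"] by (simp add: gaussian_rv_def fbm_cov_def)
  have m: "has_bochner_integral lborel (\<lambda>x. normal_density 0 1 x * x\<^sup>2) 1"
    using normal_moment_even[of 1 0 1] by (simp add: fact_numeral)
  then show "integrable N (\<lambda>\<omega>. (W \<omega> 1)\<^sup>2)"
    using distributed_integrable[OF d, of "\<lambda>x. x\<^sup>2"] by (simp add: integrable.intros)
  show "(\<integral>\<omega>. (W \<omega> 1)\<^sup>2 \<partial>N) = 1"
    using distributed_integral[OF d, of "\<lambda>x. x\<^sup>2"] m by (simp add: has_bochner_integral_integral_eq)
qed

section \<open>The bridge of the partial sum process\<close>

lemma partial_sum_process_1:
  "partial_sum_process H \<mu> X n \<omega> 1 = real n powr (-H) * (\<Sum>j=1..n. X (int j) \<omega> - \<mu>)"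
  by (simp add: partial_sum_process_def)

lemma partial_sum_process_right_continuous:
  "continuous (at_right t) (partial_sum_process H \<mu> X n \<omega>)"
proof (cases "n = 0")
  case True
  then show ?thesis by (simp add: partial_sum_process_def[abs_def])
next
  case False
  \<comment> \<open>The first grid point to the right of \<open>t\<close>; the process is constant
    up to it.\<close>
  define b where "b = (real_of_int \<lfloor>real n * t\<rfloor> + 1) / real n"
  have nb: "real n * b = real_of_int \<lfloor>real n * t\<rfloor> + 1" using False by (simp add: b_def)
  have "t < b"
    unfolding b_def using False by (simp add: pos_less_divide_eq mult.commute)
  moreover have "partial_sum_process H \<mu> X n \<omega> s = partial_sum_process H \<mu> X n \<omega> t" if s: "t < s" "s < b" for s
  proof -
    have "real n * t \<le> real n * s" "real n * s < real n * b" using s False by auto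
    then have "\<lfloor>real n * s\<rfloor> = \<lfloor>real n * t\<rfloor>"
      unfolding nb by (intro floor_unique) linarith+
    then show ?thesis by (simp add: partial_sum_process_def)
  qed
  ultimately have "\<forall>\<^sub>F s in at_right t. partial_sum_process H \<mu> X n \<omega> s = partial_sum_process H \<mu> X n \<omega> t"
    unfolding eventually_at_right_field by blast
  then show ?thesis unfolding continuous_within by (rule tendsto_eventually)
qed

lemma partial_sum_process_bounded: "bounded (partial_sum_process H \<mu> X n \<omega> ` {0..1})"
proof -
  have "partial_sum_process H \<mu> X n \<omega> ` {0..1} \<subseteq>
      (\<lambda>k. real n powr (-H) * (\<Sum>j=1..k. X (int j) \<omega> - \<mu>)) ` {0..n}"
  proof
    fix z assume "z \<in> partial_sum_process H \<mu> X n \<omega> ` {0..1}"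
    then obtain t where t: "z = partial_sum_process H \<mu> X n \<omega> t" "0 \<le> t" "t \<le> 1" by auto
    have "real n * t \<le> real n" using t by (simp add: mult_left_le)
    then have "nat \<lfloor>real n * t\<rfloor> \<in> {0..n}" by (simp add: floor_le_iff nat_le_iff)
    then show "z \<in> (\<lambda>k. real n powr (-H) * (\<Sum>j=1..k. X (int j) \<omega> - \<mu>)) ` {0..n}"
      unfolding t(1) partial_sum_process_def by blast
  qed
  then show ?thesis by (rule bounded_subset[rotated]) (simp add: finite_imp_bounded)
qed

definition max_dev :: "(int \<Rightarrow> 'a \<Rightarrow> real) \<Rightarrow> nat \<Rightarrow> 'a \<Rightarrow> real" where
  "max_dev X n \<omega> = Max ((\<lambda>k. \<bar>(\<Sum>i=1..k. X (int i) \<omega>) - real k / real n * (\<Sum>i=1..n. X (int i) \<omega>)\<bar>) ` {1..n})"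

lemma max_dev_nonneg: "n \<ge> 1 \<Longrightarrow> 0 \<le> max_dev X n \<omega>"
  unfolding max_dev_def by (intro order.trans[OF abs_ge_zero Max_ge]) auto

text \<open>The centring by \<mu> cancels exactly when the bridge uses the grid time
  \<open>k / n\<close> in place of \<open>t\<close>.\<close>

lemma bridge_partial_sum_process:
  fixes \<mu> H :: real and n :: nat and t :: real and X :: "int \<Rightarrow> 'a \<Rightarrow> real" and \<omega> :: 'a
  assumes n: "n \<ge> 1"
  defines "k \<equiv> nat \<lfloor>real n * t\<rfloor>" and "Y \<equiv> partial_sum_process H \<mu> X n \<omega>"
  shows "Y t - real k / real n * Y 1
    = real n powr (-H) * ((\<Sum>i=1..k. X (int i) \<omega>) - real k / real n * (\<Sum>i=1..n. X (int i) \<omega>))"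
  using n by (simp add: Y_def partial_sum_process_def sum_subtractf flip: k_def) (simp add: field_simps)

text \<open>At grid times the bridge is exactly the scaled deviation, which gives one inequality.
  Elsewhere \<open>t\<close> is within \<open>1 / n\<close> of the grid time to its left, and the
  slope of the bridge correction is \<open>Y 1\<close>.\<close>

lemma bridge_sup_partial_sum_process:
  fixes \<mu> H :: real and n :: nat and X :: "int \<Rightarrow> 'a \<Rightarrow> real" and \<omega> :: 'a
  assumes n: "n \<ge> 1"
  defines "Y \<equiv> partial_sum_process H \<mu> X n \<omega>"
  shows "\<bar>real n powr (-H) * max_dev X n \<omega> - bridge_sup Y\<bar> \<le> \<bar>Y 1\<bar> / real n"
proof -
  let ?d = "\<lambda>k. (\<Sum>i=1..k. X (int i) \<omega>) - real k / real n * (\<Sum>i=1..n. X (int i) \<omega>)"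
  let ?c = "real n powr (-H)"
  have bdd: "bounded (Y ` {0..1})" unfolding Y_def by (rule partial_sum_process_bounded)
  have lower: "?c * max_dev X n \<omega> \<le> bridge_sup Y"
  proof -
    have "max_dev X n \<omega> \<in> (\<lambda>k. \<bar>?d k\<bar>) ` {1..n}"
      unfolding max_dev_def using n by (intro Max_in) auto
    then obtain k where k: "k \<in> {1..n}" "max_dev X n \<omega> = \<bar>?d k\<bar>" by auto
    have fl: "nat \<lfloor>real n * (real k / real n)\<rfloor> = k" using n by simp
    have "Y (real k / real n) - real k / real n * Y 1 = ?c * ?d k"
      using bridge_partial_sum_process[OF n, of H \<mu> X \<omega> "real k / real n"] unfolding fl Y_def .
    then have "?c * max_dev X n \<omega> = \<bar>Y (real k / real n) - real k / real n * Y 1\<bar>"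
      by (simp add: k abs_mult)
    also have "\<dots> \<le> bridge_sup Y" using k by (intro bridge_le_bridge_sup bdd) auto
    finally show ?thesis .
  qed
  have upper: "bridge_sup Y \<le> ?c * max_dev X n \<omega> + \<bar>Y 1\<bar> / real n"
    unfolding bridge_sup_def
  proof (rule cSUP_least)
    fix t :: real assume t: "t \<in> {0..1}"
    define k where "k = nat \<lfloor>real n * t\<rfloor>"
    have "real n * t \<le> real n" using t by (simp add: mult_left_le)
    then have kn: "k \<le> n" unfolding k_def by (simp add: floor_le_iff nat_le_iff)
    have k1: "real k \<le> real n * t" "real n * t \<le> real k + 1" using t by (auto simp: k_def)
    have "t - real k / real n = (real n * t - real k) / real n" using n by (simp add: diff_divide_distrib)
    then have "\<bar>t - real k / real n\<bar> \<le> 1 / real n"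
      using k1 by (simp add: abs_divide divide_right_mono)
    then have b: "\<bar>(real k / real n - t) * Y 1\<bar> \<le> 1 / real n * \<bar>Y 1\<bar>"
      unfolding abs_mult by (intro mult_right_mono) (auto simp: abs_minus_commute)
    have "\<bar>?d k\<bar> \<le> max_dev X n \<omega>"
    \<comment> \<open>The maximum starts at \<open>k = 1\<close>; at \<open>k = 0\<close> the
      deviation vanishes.\<close>
    proof (cases "k = 0")
      case True then show ?thesis using max_dev_nonneg[OF n] by simp
    next
      case False then show ?thesis unfolding max_dev_def using kn by (intro Max_ge) auto
    qed
    then have "\<bar>?c * ?d k\<bar> \<le> ?c * max_dev X n \<omega>" by (simp add: abs_mult mult_left_mono)
    then have a: "\<bar>Y t - real k / real n * Y 1\<bar> \<le> ?c * max_dev X n \<omega>"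
      using bridge_partial_sum_process[OF n, of H \<mu> X \<omega> t] unfolding Y_def k_def by simp
    have "Y t - t * Y 1 = (Y t - real k / real n * Y 1) + (real k / real n - t) * Y 1"
      by (simp add: algebra_simps)
    then have "\<bar>Y t - t * Y 1\<bar> \<le> ?c * max_dev X n \<omega> + 1 / real n * \<bar>Y 1\<bar>"
      using order.trans[OF abs_triangle_ineq add_mono[OF a b]] by simp
    then show "\<bar>Y t - t * Y 1\<bar> \<le> ?c * max_dev X n \<omega> + \<bar>Y 1\<bar> / real n" by simp
  qed auto
  show ?thesis using lower upper by linarith
qed

text \<open>The identity is pointwise: where the estimator is 0, division by zero makes both sides
  0, and so it does for \<open>n = 0\<close>.\<close>

lemma scaled_kpss_T_eq:
  assumes "q n > 0"
  shows "(real (q n) / real n) powr (H - 1/2) * kpss_T X q n \<omega>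
     = real n powr (-H) * max_dev X n \<omega> * (real (q n) powr (H - 1/2) / sqrt (lrv_sq X q n \<omega>))"
proof (cases "n = 0")
  case False
  have c: "(real (q n) / real n) powr (H - 1/2) / sqrt (real n) = real (q n) powr (H - 1/2) * real n powr (-H)"
  proof -
    have "real n powr (-H) * real n powr (H - 1/2) = real n powr (- (1/2))"
      unfolding powr_add[symmetric] by simp
    also have "\<dots> = inverse (sqrt (real n))"
      by (simp add: powr_minus powr_half_sqrt)
    finally show ?thesis using False by (simp add: powr_divide field_simps)
  qed
  have "(real (q n) / real n) powr (H - 1/2) * kpss_T X q n \<omega>
      = (real (q n) / real n) powr (H - 1/2) / sqrt (real n) * max_dev X n \<omega> / sqrt (lrv_sq X q n \<omega>)"
    by (simp add: kpss_T_def max_dev_def)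
  then show ?thesis unfolding c by simp
qed simp

text \<open>Continuity of \<open>a / sqrt b\<close> at \<open>(1, c^2)\<close> confines the bad
  event to a deviation of \<open>Q n\<close>, which Markov's inequality bounds.\<close>

lemma (in prob_space) prob_tendsto_ratio_sqrt:
  fixes Q :: "nat \<Rightarrow> 'a \<Rightarrow> real" and u :: "nat \<Rightarrow> real"
  assumes [measurable]: "\<And>n. Q n \<in> borel_measurable M"
    and int: "\<forall>\<^sub>F n in sequentially. integrable M (\<lambda>\<omega>. \<bar>Q n \<omega> - c\<^sup>2\<bar>)"
    and lim: "(\<lambda>n. \<integral>\<omega>. \<bar>Q n \<omega> - c\<^sup>2\<bar> \<partial>M) \<longlonglongrightarrow> 0"
    and u: "u \<longlonglongrightarrow> 1" and c: "c > 0" and e: "e > 0"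
  shows "(\<lambda>n. prob {\<omega> \<in> space M. \<bar>u n / sqrt (Q n \<omega>) - 1 / c\<bar> \<ge> e}) \<longlonglongrightarrow> 0"
proof -
  have "isCont (\<lambda>z. fst z / sqrt (snd z)) (1, c\<^sup>2)"
    using c by (intro continuous_intros) auto
  then obtain d where d: "d > 0" "\<And>z. dist z (1, c\<^sup>2) < d \<Longrightarrow> dist (fst z / sqrt (snd z)) (1 / c) < e"
    unfolding continuous_at_eps_delta using e c by fastforce
  have close: "\<bar>a / sqrt b - 1 / c\<bar> < e" if "\<bar>a - 1\<bar> < d / 2" "\<bar>b - c\<^sup>2\<bar> < d / 2" for a b
  proof -
    have "dist (a, b) (1, c\<^sup>2) \<le> \<bar>a - 1\<bar> + \<bar>b - c\<^sup>2\<bar>"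
      unfolding dist_Pair_Pair using sqrt_sum_squares_le_sum_abs[of "a - 1" "b - c\<^sup>2"] by (simp add: dist_real_def)
    then show ?thesis using d(2)[of "(a, b)"] that by (simp add: dist_real_def)
  qed
  have "\<forall>\<^sub>F n in sequentially. dist (u n) 1 < d / 2" using d by (intro tendstoD[OF u]) simp
  with int have "\<forall>\<^sub>F n in sequentially. norm (prob {\<omega> \<in> space M. \<bar>u n / sqrt (Q n \<omega>) - 1 / c\<bar> \<ge> e})
      \<le> (\<integral>\<omega>. \<bar>Q n \<omega> - c\<^sup>2\<bar> \<partial>M) / (d / 2)"
  proof eventually_elim
    case (elim n)
    have "prob {\<omega> \<in> space M. \<bar>u n / sqrt (Q n \<omega>) - 1 / c\<bar> \<ge> e} \<le> prob {\<omega> \<in> space M. \<bar>Q n \<omega> - c\<^sup>2\<bar> \<ge> d / 2}"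
    proof (rule finite_measure_mono)
      show "{\<omega> \<in> space M. \<bar>u n / sqrt (Q n \<omega>) - 1 / c\<bar> \<ge> e} \<subseteq> {\<omega> \<in> space M. \<bar>Q n \<omega> - c\<^sup>2\<bar> \<ge> d / 2}"
        using close[of "u n"] elim(2) by (auto simp: dist_real_def not_le[symmetric])
    qed measurable
    also have "\<dots> \<le> (\<integral>\<omega>. \<bar>Q n \<omega> - c\<^sup>2\<bar> \<partial>M) / (d / 2)"
      using elim(1) d by (intro integral_Markov_inequality_measure[where A = "{}"]) auto
    finally show ?case by simp
  qed
  moreover have "(\<lambda>n. (\<integral>\<omega>. \<bar>Q n \<omega> - c\<^sup>2\<bar> \<partial>M) / (d / 2)) \<longlonglongrightarrow> 0"
    by (rule tendsto_divide_zero[OF lim])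
  ultimately show ?thesis by (rule Lim_null_comparison)
qed

text \<open>With \<open>x = n powr (2 * H)\<close> the Gaussian part is at most
  \<open>3 * (C * x)^2\<close>. The cumulant part is \<open>C * n * x\<close>, and
  \<open>n \<le> x\<close> because \<open>2 * H > 1\<close>.\<close>

lemma (in fourth_order_seq) scaled_fourth_moment_le:
  fixes H C :: real
  assumes H: "1/2 < H" and C: "0 \<le> C" and n: "n \<ge> 1"
    and G: "G n \<le> C * real n powr (2 * H - 1)"
    and K: "\<And>h. (\<Sum>r\<in>{-int n..int n}. \<Sum>s\<in>{-int n..int n}. \<bar>\<kappa> h r s\<bar>) \<le> C * real n powr (2 * H - 1)"
  shows "(\<integral>\<omega>. (real n powr (-H) * S (block n 0) \<omega>) ^ 4 \<partial>M) \<le> 3 * C\<^sup>2 + C"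
proof -
  define x where "x = real n powr (2 * H)"
  have n0: "real n > 0" "real n \<ge> 1" using n by auto
  have x: "x > 0" using n by (simp add: x_def)
  have nx: "real n * real n powr (2 * H - 1) = x" using n by (simp add: x_def powr_diff)
  have "real n powr 1 \<le> x" unfolding x_def using n0 H by (intro powr_mono) auto
  then have xn: "real n \<le> x" using n0 by simp
  have "real n * G n \<le> real n * (C * real n powr (2 * H - 1))" using G by (intro mult_left_mono) auto
  also have "\<dots> = C * x" using nx by (simp add: mult_ac)
  finally have nG: "(real n * G n)\<^sup>2 \<le> (C * x)\<^sup>2" by (intro power_mono) (auto simp: G_nonneg)
  have "(real n)\<^sup>2 * (C * real n powr (2 * H - 1)) = C * (real n * x)"
    by (simp add: power2_eq_square mult_ac flip: nx)
  also have "\<dots> \<le> C * (x * x)" using xn C x by (intro mult_left_mono mult_right_mono) auto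
  finally have nK: "(real n)\<^sup>2 * (C * real n powr (2 * H - 1)) \<le> C * x\<^sup>2" by (simp add: power2_eq_square)
  have "(real n powr (-H)) ^ 4 = real n powr (- (4 * H))"
    using n0 by (simp add: powr_power)
  also have "\<dots> = 1 / x\<^sup>2" using n0 by (simp add: x_def powr_minus_divide powr_power)
  finally have c4: "(real n powr (-H)) ^ 4 = 1 / x\<^sup>2" .
  have "(\<integral>\<omega>. (real n powr (-H) * S (block n 0) \<omega>) ^ 4 \<partial>M) = 1 / x\<^sup>2 * (\<integral>\<omega>. (S (block n 0) \<omega>) ^ 4 \<partial>M)"
    by (simp only: power_mult_distrib c4 integral_mult_right_zero)
  also have "\<dots> \<le> 1 / x\<^sup>2 * (3 * (real n * G n)\<^sup>2 + (real n)\<^sup>2 * (C * real n powr (2 * H - 1)))"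
    by (intro mult_left_mono fourth_moment_block_le K) auto
  also have "\<dots> \<le> 1 / x\<^sup>2 * (3 * (C * x)\<^sup>2 + C * x\<^sup>2)"
    using nG nK by (intro mult_left_mono add_mono) auto
  also have "\<dots> = 3 * C\<^sup>2 + C" using x by (simp add: field_simps)
  finally show ?thesis .
qed

theorem theorem3p3:
  fixes M :: "'a measure" and X :: "int \<Rightarrow> 'a \<Rightarrow> real"
    and N :: "'b measure" and W :: "'b \<Rightarrow> real \<Rightarrow> real"
    and H cH c0 :: real and q :: "nat \<Rightarrow> nat"
  assumes "prob_space M"
    and "fourth_order_stationary M X"
    and "1/2 < H" and "H < 1"
    and "is_fbm H N W"
    and "cH > 0"
    and "conv_distr_D M (partial_sum_process H (seq_mean M X) X) N (\<lambda>\<omega> t. cH * W \<omega> t)"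
    and "c0 > 0"
    and "(\<lambda>j::nat. autocov M X (int j) / (c0 * real j powr (2*H - 2))) \<longlonglongrightarrow> 1"
    and "\<exists>C. \<exists>n0. \<forall>n\<ge>n0. \<forall>h::int.
           (\<Sum>r\<in>{-int n..int n}. \<Sum>s\<in>{-int n..int n}. \<bar>cum4 M X h r s\<bar>) \<le> C * real n powr (2*H - 1)"
    and "\<forall>n. q n > 0"
    and "filterlim q at_top sequentially"
    and "(\<lambda>n. real (q n) / real n) \<longlonglongrightarrow> 0"
  shows "weak_conv_m
           (\<lambda>n. distr M borel (\<lambda>\<omega>. (real (q n) / real n) powr (H - 1/2) * kpss_T X q n \<omega>))
           (distr N borel (\<lambda>\<omega>. (SUP t\<in>{0..1}. \<bar>W \<omega> t - t * W \<omega> 1\<bar>)))"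
proof -
  note H = assms(3,4) and fbm = assms(5) and cH = assms(6) and q = assms(11-13)
  define \<mu> where "\<mu> = seq_mean M X"
  define Y where "Y = partial_sum_process H \<mu> X"
  interpret prob_space M by fact
  interpret Z: fourth_order_seq M "\<lambda>i \<omega>. X i \<omega> - \<mu>" "autocov M X" "cum4 M X"
    unfolding \<mu>_def by (rule fourth_order_seq_centered[OF assms(1,2)])
  have N: "prob_space N" and Wc: "\<And>\<omega>. \<omega> \<in> space N \<Longrightarrow> continuous_on {0..1} (W \<omega>)"
    using fbm by (auto simp: is_fbm_def)
  interpret N: prob_space N by fact
  have [measurable]: "X i \<in> borel_measurable M" for i
    using assms(2) by (simp add: fourth_order_stationary_def)
  have [measurable]: "(\<lambda>\<omega>. W \<omega> 1) \<in> borel_measurable N" by (rule fbm_measurable[OF fbm]) simp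

  \<comment> \<open>Growth bounds with a common constant\<close>
  obtain C1 where C1: "C1 \<ge> 0" "\<And>n. n \<ge> 1 \<Longrightarrow> Z.G n \<le> C1 * real n powr (2 * H - 1)"
    using Z.G_bound[OF H assms(8,9)] by blast
  obtain C2 where C2: "C2 \<ge> 0" "\<And>n h. n \<ge> 1 \<Longrightarrow>
      (\<Sum>r\<in>{-int n..int n}. \<Sum>s\<in>{-int n..int n}. \<bar>cum4 M X h r s\<bar>) \<le> C2 * real n powr (2*H - 1)"
    using cumulant_sum_bound[OF H(1) assms(10)] by blast
  define C where "C = C1 + C2"
  have C: "C \<ge> 0" using C1(1) C2(1) by (simp add: C_def)
  have GC: "Z.G n \<le> C * real n powr (2 * H - 1)" if "n \<ge> 1" for n
    by (rule order.trans[OF C1(2)[OF that] mult_right_mono]) (use C2(1) in \<open>auto simp: C_def\<close>)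
  have KC: "(\<Sum>r\<in>{-int n..int n}. \<Sum>s\<in>{-int n..int n}. \<bar>cum4 M X h r s\<bar>) \<le> C * real n powr (2*H - 1)"
    if "n \<ge> 1" for n h
    by (rule order.trans[OF C2(2)[OF that] mult_right_mono]) (use C1(1) in \<open>auto simp: C_def\<close>)

  \<comment> \<open>The link between the two halves of the argument: the process at time 1 is a
    normalised sum over one block.\<close>
  have Y1: "Y n \<omega> 1 = real n powr (-H) * Z.S (block n 0) \<omega>" for n \<omega>
    unfolding Y_def partial_sum_process_1 Z.S_def Z.block_0 sum_int_atLeastAtMost ..
  have Y1_sq: "(Y n \<omega> 1)\<^sup>2 = (Z.S (block n 0) \<omega>)\<^sup>2 / real n powr (2 * H)" for n \<omega>
  proof -
    have "(real n powr (-H))\<^sup>2 = real n powr (- (2 * H))"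
      unfolding power2_eq_square powr_add[symmetric] by simp
    then show ?thesis unfolding Y1 power_mult_distrib by (simp add: powr_minus_divide)
  qed
  have mY [measurable]: "(\<lambda>\<omega>. Y n \<omega> t) \<in> borel_measurable M" for n t
    unfolding Y_def partial_sum_process_def by measurable
  have distr_conv: "(\<lambda>n. \<integral>\<omega>. f (Y n \<omega>) \<partial>M) \<longlonglongrightarrow> (\<integral>\<omega>. f (\<lambda>t. cH * W \<omega> t) \<partial>N)"
    if "skorokhod_bdd_cont f" "\<And>n. (\<lambda>\<omega>. f (Y n \<omega>)) \<in> borel_measurable M"
      "(\<lambda>\<omega>. f (\<lambda>t. cH * W \<omega> t)) \<in> borel_measurable N" for f
    using assms(7) that unfolding conv_distr_D_def Y_def \<mu>_def by blast

  \<comment> \<open>Second moment of the normalised sum\<close>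
  have second: "(\<lambda>n. \<integral>\<omega>. (Y n \<omega> 1)\<^sup>2 \<partial>M) \<longlonglongrightarrow> (\<integral>\<omega>. (cH * W \<omega> 1)\<^sup>2 \<partial>N)"
  proof (rule second_moment_tendsto[OF N, where B = "3 * C\<^sup>2 + C"])
    show "integrable M (\<lambda>\<omega>. (Y n \<omega> 1)\<^sup>2)" for n
      unfolding Y1_sq by (intro integrable_divide Z.integrable_S_square)
    show "integrable M (\<lambda>\<omega>. Y n \<omega> 1 ^ 4)" for n
      using Z.integrable_S_square_mult[of "block n 0" "block n 0"]
      unfolding Y1 power_mult_distrib by (simp flip: power_add)
    show "(\<integral>\<omega>. Y n \<omega> 1 ^ 4 \<partial>M) \<le> 3 * C\<^sup>2 + C" if "n \<ge> 1" for n
      unfolding Y1 using that by (intro Z.scaled_fourth_moment_le H C GC KC)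
    show "integrable N (\<lambda>\<omega>. (cH * W \<omega> 1)\<^sup>2)"
      using fbm_1_second_moment(1)[OF fbm] by (simp add: power_mult_distrib)
    show "(\<lambda>n. \<integral>\<omega>. g (Y n \<omega> 1) \<partial>M) \<longlonglongrightarrow> (\<integral>\<omega>. g (cH * W \<omega> 1) \<partial>N)"
      if g: "continuous_on UNIV g" "\<And>z. \<bar>g z\<bar> \<le> b" for g :: "real \<Rightarrow> real" and b
    proof (rule distr_conv[of "\<lambda>x. g (x 1)"])
      have [measurable]: "g \<in> borel_measurable borel" using g(1) by (rule borel_measurable_continuous_onI)
      show "(\<lambda>\<omega>. g (Y n \<omega> 1)) \<in> borel_measurable M" for n by measurable
      show "(\<lambda>\<omega>. g (cH * W \<omega> 1)) \<in> borel_measurable N" by measurable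
    qed (rule skorokhod_bdd_cont_endpoint[OF g])
  qed measurable
  then have second: "(\<lambda>n. \<integral>\<omega>. (Y n \<omega> 1)\<^sup>2 \<partial>M) \<longlonglongrightarrow> cH\<^sup>2"
    using fbm_1_second_moment(2)[OF fbm] by (simp add: power_mult_distrib)
  \<comment> \<open>Read at sample size \<open>p\<close>, the convergence fixes the mean of a
    squared window sum of length \<open>p\<close>.\<close>
  then have v: "(\<lambda>p. Z.R (block p 0) (block p 0) / real p powr (2 * H)) \<longlonglongrightarrow> cH\<^sup>2"
    unfolding Y1_sq by (simp add: Z.integral_S_square)

  \<comment> \<open>The estimator in terms of window sums\<close>
  define p where "p n = q n + 1" for n
  define Q where "Q n \<omega> = (\<Sum>m\<in>{- int (q n)..<int n}. (Z.window_sum n (p n) m \<omega>)\<^sup>2) / (real n * real (p n) powr (2 * H))" for n \<omega>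
  \<comment> \<open>The statistic is scaled with \<open>q\<close>, the windows have length
    \<open>q + 1\<close>; \<open>u\<close> is the resulting correction, tending to 1.\<close>
  define u where "u n = (real (q n) / real (p n)) powr (H - 1/2)" for n
  have mQ [measurable]: "Q n \<in> borel_measurable M" for n
    unfolding Q_def[abs_def] by measurable
  note Qlim = Z.window_squares_tendsto[OF H C GC KC q(2,3) v, folded p_def, folded Q_def]
  have u: "u \<longlonglongrightarrow> 1"
  proof -
    have "(\<lambda>n. 1 - 1 / real (Suc (q n))) \<longlonglongrightarrow> 1 - 0"
      by (intro tendsto_intros filterlim_compose[OF LIMSEQ_Suc[OF lim_1_over_n] q(2)])
    moreover have "1 - 1 / real (Suc (q n)) = real (q n) / real (p n)" for n
      by (simp add: p_def field_simps)
    ultimately have "(\<lambda>n. real (q n) / real (p n)) \<longlonglongrightarrow> 1" by simp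
    then have "u \<longlonglongrightarrow> 1 powr (H - 1/2)" unfolding u_def[abs_def] by (intro tendsto_intros) auto
    then show ?thesis by simp
  qed
  have lrv: "lrv_sq X q n \<omega> = Q n \<omega> * real (p n) powr (2 * H - 1)" if n: "n \<ge> 1" for n \<omega>
  proof -
    have "Z.S {1..int n} \<omega> / real n = sample_mean X n \<omega> - \<mu>"
      using n by (simp add: Z.S_def sum_int_atLeastAtMost sum_subtractf sample_mean_def field_simps)
    then have "Z.window_sum n (p n) m \<omega> = (\<Sum>i\<in>{m + 1..m + int (q n + 1)} \<inter> {1..int n}. X i \<omega> - sample_mean X n \<omega>)" for m
      by (simp add: Z.window_sum_def block_def p_def)
    then have "lrv_sq X q n \<omega> = (\<Sum>m\<in>{- int (q n)..<int n}. (Z.window_sum n (p n) m \<omega>)\<^sup>2) / (real n * real (p n))"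
      unfolding lrv_sq_window_sum by (simp add: p_def)
    moreover have "real (p n) powr (2 * H) = real (p n) * real (p n) powr (2 * H - 1)"
      by (simp add: p_def powr_diff)
    ultimately show ?thesis using n by (simp add: Q_def p_def)
  qed
  have scale: "real (q n) powr (H - 1/2) / sqrt (lrv_sq X q n \<omega>) = u n / sqrt (Q n \<omega>)" if "n \<ge> 1" for n \<omega>
  proof -
    have "real (p n) powr (2 * H - 1) = (real (p n) powr (H - 1/2))\<^sup>2"
      by (simp add: power2_eq_square p_def flip: powr_add)
    then have "sqrt (lrv_sq X q n \<omega>) = sqrt (Q n \<omega>) * real (p n) powr (H - 1/2)"
      unfolding lrv[OF that] by (simp add: real_sqrt_mult)
    then show ?thesis by (simp add: u_def p_def powr_divide)
  qed
  have ratio: "(\<lambda>n. prob {\<omega> \<in> space M. \<bar>real (q n) powr (H - 1/2) / sqrt (lrv_sq X q n \<omega>) - 1 / cH\<bar> \<ge> e}) \<longlonglongrightarrow> 0"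
    if "e > 0" for e
  proof (rule Lim_transform_eventually[OF prob_tendsto_ratio_sqrt[OF mQ Qlim u cH that]])
    show "\<forall>\<^sub>F n in sequentially. prob {\<omega> \<in> space M. e \<le> \<bar>u n / sqrt (Q n \<omega>) - 1 / cH\<bar>} =
        prob {\<omega> \<in> space M. \<bar>real (q n) powr (H - 1/2) / sqrt (lrv_sq X q n \<omega>) - 1 / cH\<bar> \<ge> e}"
      by (rule eventually_sequentiallyI[of 1]) (simp add: scale)
  qed

  \<comment> \<open>Measurability of the path functionals\<close>
  have bW: "bounded (W \<omega> ` {0..1})" if "\<omega> \<in> space N" for \<omega>
    using Wc[OF that] by (intro compact_imp_bounded compact_continuous_image) auto
  have V_eq: "bridge_sup (\<lambda>t. cH * W \<omega> t) = cH * bridge_sup (W \<omega>)" if "\<omega> \<in> space N" for \<omega>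
    using cH bW[OF that] by (intro bridge_sup_cmult) auto
  have [measurable]: "(\<lambda>\<omega>. bridge_sup (W \<omega>)) \<in> borel_measurable N"
  proof (rule borel_measurable_bridge_sup)
    fix \<omega> and t :: real assume w: "\<omega> \<in> space N" and t: "t \<in> {0..<1}"
    have "(W \<omega> \<longlongrightarrow> W \<omega> t) (at t within {0..1})"
      using Wc[OF w] t by (auto simp: continuous_on_def)
    then have "(W \<omega> \<longlongrightarrow> W \<omega> t) (at t within {t..1})"
      by (rule tendsto_within_subset) (use t in auto)
    then show "continuous (at_right t) (W \<omega>)"
      using t by (simp add: continuous_within at_within_Icc_at_right)
  qed (auto intro: fbm_measurable[OF fbm] bW)
  then have [measurable]: "(\<lambda>\<omega>. bridge_sup (\<lambda>t. cH * W \<omega> t)) \<in> borel_measurable N"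
    by (simp cong: measurable_cong add: V_eq)
  have [measurable]: "(\<lambda>\<omega>. bridge_sup (Y n \<omega>)) \<in> borel_measurable M" for n
    using mY unfolding Y_def
    by (intro borel_measurable_bridge_sup partial_sum_process_right_continuous partial_sum_process_bounded)
  have [measurable]: "max_dev X n \<in> borel_measurable M" for n
    unfolding max_dev_def[abs_def] by measurable
  have [measurable]: "lrv_sq X q n \<in> borel_measurable M" for n
    unfolding lrv_sq_def[abs_def] sample_autocov_def sample_mean_def by measurable

  \<comment> \<open>The discretisation error in mean\<close>
  have intY: "integrable M (\<lambda>\<omega>. \<bar>Y n \<omega> 1\<bar> / real n)" "(\<integral>\<omega>. \<bar>Y n \<omega> 1\<bar> / real n \<partial>M) \<le> (1 + (\<integral>\<omega>. (Y n \<omega> 1)\<^sup>2 \<partial>M)) / real n" for n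
  proof -
    have i2: "integrable M (\<lambda>\<omega>. (Y n \<omega> 1)\<^sup>2)"
      unfolding Y1_sq by (intro integrable_divide Z.integrable_S_square)
    then have i2': "integrable M (\<lambda>\<omega>. (1 + (Y n \<omega> 1)\<^sup>2) / real n)" by simp
    have le: "\<bar>Y n \<omega> 1\<bar> / real n \<le> (1 + (Y n \<omega> 1)\<^sup>2) / real n" for \<omega>
      using abs_le_eps_plus_square[of 1 "Y n \<omega> 1"] by (intro divide_right_mono) auto
    show i1: "integrable M (\<lambda>\<omega>. \<bar>Y n \<omega> 1\<bar> / real n)"
      by (rule Bochner_Integration.integrable_bound[OF i2'])
        (use order.trans[OF le abs_ge_self] in \<open>auto simp: abs_divide\<close>)
    have "(\<integral>\<omega>. \<bar>Y n \<omega> 1\<bar> / real n \<partial>M) \<le> (\<integral>\<omega>. (1 + (Y n \<omega> 1)\<^sup>2) / real n \<partial>M)"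
      by (rule integral_mono[OF i1 i2' le])
    then show "(\<integral>\<omega>. \<bar>Y n \<omega> 1\<bar> / real n \<partial>M) \<le> (1 + (\<integral>\<omega>. (Y n \<omega> 1)\<^sup>2 \<partial>M)) / real n"
      using i2 by (simp add: prob_space)
  qed
  have E_lim: "(\<lambda>n. \<integral>\<omega>. \<bar>Y n \<omega> 1\<bar> / real n \<partial>M) \<longlonglongrightarrow> 0"
  proof (rule Lim_null_comparison)
    show "\<forall>\<^sub>F n in sequentially. norm (\<integral>\<omega>. \<bar>Y n \<omega> 1\<bar> / real n \<partial>M) \<le> (1 + (\<integral>\<omega>. (Y n \<omega> 1)\<^sup>2 \<partial>M)) * (1 / real n)"
      using intY(2) by (intro always_eventually allI) simp
    have "(\<lambda>n. (1 + (\<integral>\<omega>. (Y n \<omega> 1)\<^sup>2 \<partial>M)) * (1 / real n)) \<longlonglongrightarrow> (1 + cH\<^sup>2) * 0"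
      by (intro tendsto_intros second lim_1_over_n)
    then show "(\<lambda>n. (1 + (\<integral>\<omega>. (Y n \<omega> 1)\<^sup>2 \<partial>M)) * (1 / real n)) \<longlonglongrightarrow> 0" by simp
  qed

  \<comment> \<open>Limit of the product\<close>
  have "weak_conv_m
      (\<lambda>n. distr M borel (\<lambda>\<omega>. real n powr (-H) * max_dev X n \<omega> * (real (q n) powr (H - 1/2) / sqrt (lrv_sq X q n \<omega>))))
      (distr N borel (\<lambda>\<omega>. 1 / cH * bridge_sup (\<lambda>t. cH * W \<omega> t)))"
  proof (rule weak_conv_mult_nonneg[OF N])
    show "0 \<le> real n powr (-H) * max_dev X n \<omega>" for n \<omega>
      by (cases "n = 0") (auto simp: max_dev_nonneg)
    fix x y s :: real assume xy: "x < y" and s: "s > 0"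
    show "(\<lambda>n. \<integral>\<omega>. cts_step x y (s * (real n powr (-H) * max_dev X n \<omega>)) \<partial>M)
        \<longlonglongrightarrow> (\<integral>\<omega>. cts_step x y (s * bridge_sup (\<lambda>t. cH * W \<omega> t)) \<partial>N)"
    proof (rule cts_step_tendsto_close[OF _ _ intY(1) E_lim _ xy s])
      show "\<bar>real n powr (-H) * max_dev X n \<omega> - bridge_sup (Y n \<omega>)\<bar> \<le> \<bar>Y n \<omega> 1\<bar> / real n" if "n \<ge> 1" for n \<omega>
        unfolding Y_def by (rule bridge_sup_partial_sum_process[OF that])
      show "(\<lambda>n. \<integral>\<omega>. cts_step x y (s * bridge_sup (Y n \<omega>)) \<partial>M)
          \<longlonglongrightarrow> (\<integral>\<omega>. cts_step x y (s * bridge_sup (\<lambda>t. cH * W \<omega> t)) \<partial>N)"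
      proof (rule distr_conv)
        \<comment> \<open>The scale \<open>s\<close> is absorbed into the bounded continuous outer
          function.\<close>
        show "skorokhod_bdd_cont (\<lambda>z. cts_step x y (s * bridge_sup z))"
        proof (rule skorokhod_bdd_cont_bridge_sup[where B = 1])
          show "continuous_on UNIV (\<lambda>z. cts_step x y (s * z))"
            by (rule continuous_on_compose2[OF continuous_on_cts_step[OF xy]]) (auto intro!: continuous_intros)
          show "\<bar>cts_step x y (s * z)\<bar> \<le> 1" for z using cts_step_range[OF xy, of "s * z"] by simp
        qed
      qed measurable
    qed measurable
  qed (use cH ratio in auto)
  \<comment> \<open>The limit constant of the numerator cancels against that of the estimator, since
    the bridge supremum is positively homogeneous.\<close>
  moreover have "distr N borel (\<lambda>\<omega>. 1 / cH * bridge_sup (\<lambda>t. cH * W \<omega> t)) = distr N borel (\<lambda>\<omega>. SUP t\<in>{0..1}. \<bar>W \<omega> t - t * W \<omega> 1\<bar>)"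
    using cH by (intro distr_cong) (auto simp: V_eq simp flip: bridge_sup_def)
  ultimately show ?thesis using q(1) by (simp only: scaled_kpss_T_eq)
qed

end
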